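(* Let $n\geq 3$. If $n\equiv 0$ or $2 \pmod 3$, then $$\operatorname{depth}(S_{n,3}/I(\mathcal{C}_{n,3}))=\operatorname{sdepth}(S_{n,3}/I(\mathcal{C}_{n,3}))=\left\lceil\frac{n-1}{3}\right\rceil,$$ and if $n\equiv 1\pmod 3$, then both $d=\operatorname{depth}(S_{n,3}/I(\mathcal{C}_{n,3}))$ and $d=\operatorname{sdepth}(S_{n,3}/I(\mathcal{C}_{n,3}))$ satisfy $$\left\lceil\frac{n-1}{3}\right\rceil\leq d\leq \left\lceil\frac{n}{3}\right\rceil.$$
   Context: $K$ is a field. For a finite simple graph $G$ whose vertices are the variables of a polynomial ring over $K$, the edge ideal $I(G)$ is the squarefree monomial ideal generated by all products $uv$ with $\{u,v\}\in E(G)$. $P_m$ is the path on $m$ vertices ($P_1$ is a single vertex with no edges) and $C_n$ ($n\ge 3$) is the cycle on $n$ vertices. The strong product $G_1\boxtimes G_2$ has vertex set $V(G_1)\times V(G_2)$, and two distinct vertices $(v_1,u_1),(v_2,u_2)$ are adjacent iff each coordinate pair is equal or adjacent ($v_1=v_2$ or $v_1v_2\in E(G_1)$, and $u_1=u_2$ or $u_1u_2\in E(G_2)$). Put $\mathcal{C}_{n,m}:=C_n\boxtimes P_m$, with vertices labelled by variables $x_{ij}$ ($1\le i\le n$, $1\le j\le m$), so that distinct $x_{ij},x_{kl}$ are adjacent iff $i-k\in\{-1,0,1\}$ modulo $n$ and $|j-l|\le 1$. $S_{n,m}:=K[x_{ij}:1\le i\le n,\ 1\le j\le m]$. Depth is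 taken with respect to the graded maximal ideal generated by all the variables. Stanley depth: let $S=K[x_1,\dots,x_N]$ and $M$ a finitely generated $\mathbb{Z}^N$-graded $S$-module. A Stanley decomposition $\mathcal{D}$ of $M$ is a finite direct sum of $K$-vector spaces $M=\bigoplus_{i=1}^r w_iK[A_i]$ with $w_i\in M$ homogeneous, $A_i\subseteq\{x_1,\dots,x_N\}$, where $w_iK[A_i]$ (the $K$-span of all $w_iu$, $u$ a monomial in $K[A_i]$) is a free $K[A_i]$-module. $\operatorname{sdepth}(\mathcal{D})=\min_i|A_i|$ and $\operatorname{sdepth}(M)$ is the maximum of $\operatorname{sdepth}(\mathcal{D})$ over all Stanley decompositions $\mathcal{D}$ of $M$. *)

theory Defs
  imports Complex_Main "HOL-Library.Poly_Mapping" "HOL-Algebra.Module" "HOL-Algebra.QuotRing"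
begin

section \<open>Finite simple graphs\<close>

text \<open>A graph is a pair of its vertex set and its set of edges, each edge being a two-element set.\<close>

type_synonym 'v ugraph = "'v set \<times> 'v set set"

abbreviation verts :: "'v ugraph \<Rightarrow> 'v set" where "verts G \<equiv> fst G"
abbreviation edges :: "'v ugraph \<Rightarrow> 'v set set" where "edges G \<equiv> snd G"

definition path_graph :: "nat \<Rightarrow> nat ugraph" where
  "path_graph m = ({1..m}, {{j, j + 1} | j. 1 \<le> j \<and> j + 1 \<le> m})"

text \<open>Only meaningful for \<open>n \<ge> 3\<close>.\<close>

definition cycle_graph :: "nat \<Rightarrow> nat ugraph" where
  "cycle_graph n = ({1..n}, insert {n, 1} {{i, i + 1} | i. 1 \<le> i \<and> i + 1 \<le> n})"

definition strong_product :: "'a ugraph \<Rightarrow> 'b ugraph \<Rightarrow> ('a \<times> 'b) ugraph" where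
  "strong_product G H =
    (verts G \<times> verts H,
     {{(v1, u1), (v2, u2)} | v1 u1 v2 u2.
        (v1, u1) \<in> verts G \<times> verts H \<and> (v2, u2) \<in> verts G \<times> verts H \<and>
        (v1, u1) \<noteq> (v2, u2) \<and>
        (v1 = v2 \<or> {v1, v2} \<in> edges G) \<and> (u1 = u2 \<or> {u1, u2} \<in> edges H)})"


section \<open>Polynomial rings and edge ideals\<close>

text \<open>
  Exponent vectors are finitely supported functions from variables to \<open>nat\<close>, and polynomials are
  finitely supported functions from exponent vectors to the coefficient field. The type admits all
  elements of \<open>'v\<close> as variables; \<open>mpoly_ring V\<close> is the subring of the polynomials in the
  variables in \<open>V\<close>.
\<close>

type_synonym ('v, 'k) mpol = "('v \<Rightarrow>\<^sub>0 nat) \<Rightarrow>\<^sub>0 'k"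

definition mpoly_ring :: "'v set \<Rightarrow> ('v, 'k::field) mpol ring" where
  "mpoly_ring V =
    \<lparr>carrier = {p. \<forall>e\<in>Poly_Mapping.keys p. Poly_Mapping.keys e \<subseteq> V},
     monoid.mult = (*), one = 1, zero = 0, add = (+)\<rparr>"

definition mvar :: "'v \<Rightarrow> ('v, 'k::field) mpol" where
  "mvar v = Poly_Mapping.single (Poly_Mapping.single v 1) 1"

definition max_graded_ideal :: "'v set \<Rightarrow> ('v, 'k::field) mpol set" where
  "max_graded_ideal V = Idl\<^bsub>mpoly_ring V\<^esub> (mvar ` V)"

definition edge_ideal :: "'v ugraph \<Rightarrow> ('v, 'k::field) mpol set" where
  "edge_ideal G = Idl\<^bsub>mpoly_ring (verts G)\<^esub> {mvar u * mvar v | u v. {u, v} \<in> edges G}"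


section \<open>Quotients as modules, and depth\<close>

definition quot_module :: "('a, 'c) ring_scheme \<Rightarrow> 'a set \<Rightarrow> ('a, 'a set) module" where
  "quot_module R I =
    \<lparr>carrier = carrier (R Quot I), monoid.mult = monoid.mult (R Quot I), one = one (R Quot I),
     zero = zero (R Quot I), add = add (R Quot I),
     smult = (\<lambda>a x. (I +>\<^bsub>R\<^esub> a) \<otimes>\<^bsub>R Quot I\<^esub> x)\<rparr>"

text \<open>The submodule \<open>f\<^sub>1M + \<dots> + f\<^sub>rM\<close>.\<close>

definition seq_mult :: "('b, 'm, 'c) module_scheme \<Rightarrow> 'b list \<Rightarrow> 'm set" where
  "seq_mult M fs =
    {finsum M (\<lambda>i. (fs ! i) \<odot>\<^bsub>M\<^esub> x i) {..<length fs} | x. x \<in> {..<length fs} \<rightarrow> carrier M}"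

text \<open>
  The second condition says that \<open>f\<^sub>i\<close> is a nonzerodivisor on
  \<open>M / (f\<^sub>1, \<dots>, f\<^bsub>i-1\<^esub>)M\<close>, expressed by representatives.
\<close>

definition regular_sequence ::
    "('a, 'd) ring_scheme \<Rightarrow> ('a, 'm, 'c) module_scheme \<Rightarrow> 'a list \<Rightarrow> bool" where
  "regular_sequence R M fs \<longleftrightarrow>
    set fs \<subseteq> carrier R \<and>
    (\<forall>i<length fs. \<forall>x\<in>carrier M.
       (fs ! i) \<odot>\<^bsub>M\<^esub> x \<in> seq_mult M (take i fs) \<longrightarrow> x \<in> seq_mult M (take i fs)) \<and>
    seq_mult M fs \<noteq> carrier M"

text \<open>
  The maximum exists for \<open>M = S/I\<close> with \<open>S\<close> a polynomial ring in finitely many variables, \<open>I\<close> a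
  proper homogeneous ideal and \<open>J\<close> the graded maximal ideal: the empty sequence is regular, and the
  dimension bounds the lengths. Similarly for the maximum and the minimum in the definition of
  Stanley depth below, as every Stanley decomposition of a nonzero module is nonempty.
\<close>

definition depth ::
    "('a, 'd) ring_scheme \<Rightarrow> 'a set \<Rightarrow> ('a, 'm, 'c) module_scheme \<Rightarrow> nat" where
  "depth R J M = Max {length fs | fs. set fs \<subseteq> J \<and> regular_sequence R M fs}"


section \<open>Stanley depth\<close>

text \<open>
  A grading of a module is given by the family of its homogeneous components. The component of
  the polynomial ring in degree \<open>a\<close> is spanned by the monomial with exponent \<open>a\<close>, and is \<open>{0}\<close> if
  there is no such monomial.
\<close>

definition mpoly_component :: "'v set \<Rightarrow> ('v \<Rightarrow> int) \<Rightarrow> ('v, 'k::field) mpol set" where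
  "mpoly_component V a =
    {p \<in> carrier (mpoly_ring V). \<forall>e\<in>Poly_Mapping.keys p. \<forall>v. int (Poly_Mapping.lookup e v) = a v}"

definition quot_component ::
    "'v set \<Rightarrow> ('v, 'k::field) mpol set \<Rightarrow> ('v \<Rightarrow> int) \<Rightarrow> ('v, 'k) mpol set set" where
  "quot_component V I a = (\<lambda>p. I +>\<^bsub>mpoly_ring V\<^esub> p) ` mpoly_component V a"

definition stanley_space ::
    "(('v, 'k::field) mpol, 'm, 'c) module_scheme \<Rightarrow> 'm \<Rightarrow> 'v set \<Rightarrow> 'm set" where
  "stanley_space M w A = (\<lambda>p. p \<odot>\<^bsub>M\<^esub> w) ` carrier (mpoly_ring A)"

text \<open>
  The third condition says that \<open>wK[A]\<close> is free over \<open>K[A]\<close> with basis \<open>w\<close>; in particular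
  \<open>w \<noteq> 0\<close>. The last one says that \<open>M\<close> is the direct sum of the spaces \<open>wK[A]\<close>.
\<close>

definition stanley_decomposition ::
    "'v set \<Rightarrow> (('v, 'k::field) mpol, 'm, 'c) module_scheme \<Rightarrow> (('v \<Rightarrow> int) \<Rightarrow> 'm set) \<Rightarrow>
     ('m \<times> 'v set) list \<Rightarrow> bool" where
  "stanley_decomposition V M gr D \<longleftrightarrow>
    (\<forall>(w, A)\<in>set D. A \<subseteq> V) \<and>
    (\<forall>(w, A)\<in>set D. w \<in> carrier M \<and> (\<exists>a. w \<in> gr a)) \<and>
    (\<forall>(w, A)\<in>set D. \<forall>p\<in>carrier (mpoly_ring A). p \<odot>\<^bsub>M\<^esub> w = \<zero>\<^bsub>M\<^esub> \<longrightarrow> p = 0) \<and>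
    (\<forall>x\<in>carrier M.
       \<exists>!y. y \<in> (\<Pi>\<^sub>E i\<in>{..<length D}. stanley_space M (fst (D ! i)) (snd (D ! i))) \<and>
            x = finsum M y {..<length D})"

definition stanley_decomposition_depth :: "('m \<times> 'v set) list \<Rightarrow> nat" where
  "stanley_decomposition_depth D = Min ((\<lambda>(w, A). card A) ` set D)"

definition sdepth ::
    "'v set \<Rightarrow> (('v, 'k::field) mpol, 'm, 'c) module_scheme \<Rightarrow> (('v \<Rightarrow> int) \<Rightarrow> 'm set) \<Rightarrow> nat" where
  "sdepth V M gr = Max {stanley_decomposition_depth D | D. stanley_decomposition V M gr D}"



definition depth_quot :: "'v set \<Rightarrow> ('v, 'k::field) mpol set \<Rightarrow> nat" where
  "depth_quot V I = depth (mpoly_ring V) (max_graded_ideal V) (quot_module (mpoly_ring V) I)"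

definition sdepth_quot :: "'v set \<Rightarrow> ('v, 'k::field) mpol set \<Rightarrow> nat" where
  "sdepth_quot V I = sdepth V (quot_module (mpoly_ring V) I) (quot_component V I)"

end

theory Submission
  imports Defs
begin

text \<open>
  Write \<open>S\<close> for the polynomial ring and \<open>I\<close> for the edge ideal. Both invariants lie between
  \<open>(n + 1) div 3 = \<lceil>(n - 1) / 3\<rceil>\<close> and \<open>(n + 2) div 3 = \<lceil>n / 3\<rceil>\<close>, and these two numbers differ only for
  \<open>n \<equiv> 1 (mod 3)\<close>. The ideal \<open>I\<close> is the Stanley--Reisner ideal of the complex \<open>\<Delta>\<close> of independent
  vertex sets of the graph, and everything is read off from \<open>\<Delta>\<close>.

  For the lower bounds, a vertex \<open>v\<close> splits \<open>\<Delta>\<close> into the faces that avoid \<open>v\<close> (the deletion, \<open>I + (v)\<close>)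
  and the faces that \<open>v\<close> can be added to (the star, \<open>I : v\<close>), matching the exact sequence
  \<open>0 \<rightarrow> S/(I : v) \<rightarrow> S/I \<rightarrow> S/(I + (v)) \<rightarrow> 0\<close>. If repeated splitting ends in simplices with at least \<open>t\<close>
  vertices (\<open>splits t \<Delta>\<close>), then both invariants are at least \<open>t\<close>. For Stanley depth, the splitting
  partitions \<open>\<Delta>\<close> into intervals \<open>[T, B]\<close> with \<open>card B \<ge> t\<close> (\<open>splits_interval_partition\<close>), that is, \<open>S/I\<close>
  into spaces \<open>x\<^sub>T K[B]\<close>. For depth one wants a single sequence that is regular on all pieces: the
  elementary symmetric polynomials \<open>e\<^sub>1, \<dots>, e\<^sub>t\<close> of all variables. Over every field they restrict to a
  regular sequence on each simplex with at least \<open>t\<close> vertices (\<open>elem_syms_regular_simplex\<close>), and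
  weak regularity passes from the two ends of a short exact sequence to its middle term
  (\<open>weakly_regular_exact\<close>).

  The complex of independent sets splits with \<open>t = card W\<close> as soon as the vertices in \<open>W\<close> have
  pairwise disjoint closed neighbourhoods (\<open>packing_splits\<close>). The closed neighbourhood of a vertex in
  the middle row consists of three whole columns, so every third column gives \<open>n div 3\<close> such vertices.
  For \<open>n \<equiv> 2 (mod 3)\<close> one more is gained by splitting first at the three vertices of one column, which
  opens the cycle.

  For the upper bounds, let \<open>A\<close> be a facet of \<open>\<Delta>\<close>. Then \<open>I : x\<^sub>A\<close> is generated by the variables outside
  \<open>A\<close>, so \<open>x\<^sub>A S\<close> is a copy of \<open>K[A]\<close> inside \<open>S/I\<close>. In a Stanley decomposition the piece that
  contributes to \<open>x\<^sub>A\<close> can only use variables in \<open>A\<close> (\<open>facet_bounds_stanley\<close>). For a regular sequence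
  \<open>f\<^sub>1, \<dots>, f\<^sub>r\<close>, the powers \<open>f\<^sub>i\<^sup>k\<close> are again regular, and for \<open>k > card A\<close> the element \<open>x\<^sub>A\<close> does not lie
  in \<open>I + (f\<^sub>1\<^sup>k, \<dots>, f\<^sub>r\<^sup>k)\<close>; then distinct monomials in the \<open>f\<^sub>i\<^sup>k\<close>, applied to \<open>x\<^sub>A\<close>, are linearly
  independent over \<open>K\<close>, and counting dimensions in \<open>K[A]\<close> gives \<open>r \<le> card A\<close>
  (\<open>facet_bounds_regular\<close>). Suitable \<open>\<lceil>n / 3\<rceil>\<close> vertices of the middle row form such a facet, because
  their closed neighbourhoods cover all columns (\<open>grid_facet\<close>).
\<close>

section \<open>Weakly regular sequences\<close>

text \<open>
  The type of polynomials has all elements of \<open>'v\<close> as variables, and the ring in question is the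
  subring on finitely many of them; so ideals, cosets and regularity are relative to a subring \<open>S\<close>.
\<close>

locale ambient_subring =
  fixes S :: "'a::comm_ring_1 set"
  assumes one_S: "1 \<in> S"
    and add_S: "a \<in> S \<Longrightarrow> b \<in> S \<Longrightarrow> a + b \<in> S"
    and mult_S: "a \<in> S \<Longrightarrow> b \<in> S \<Longrightarrow> a * b \<in> S"
    and uminus_S: "a \<in> S \<Longrightarrow> - a \<in> S"
begin

lemma diff_S: "a \<in> S \<Longrightarrow> b \<in> S \<Longrightarrow> a - b \<in> S"
  using add_S[of a "- b"] uminus_S[of b] by simp

lemma zero_S: "0 \<in> S"
  using diff_S[OF one_S one_S] by simp

lemma power_S: "a \<in> S \<Longrightarrow> a ^ k \<in> S"
  by (induction k) (auto simp: one_S mult_S)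

lemma sum_S: "(\<And>i. i \<in> A \<Longrightarrow> g i \<in> S) \<Longrightarrow> sum g A \<in> S"
  by (induction A rule: infinite_finite_induct) (auto simp: zero_S add_S)

lemmas S_intros = one_S add_S mult_S uminus_S diff_S zero_S power_S

definition is_ideal :: "'a set \<Rightarrow> bool" where
  "is_ideal J \<longleftrightarrow> J \<subseteq> S \<and> 0 \<in> J \<and> (\<forall>a\<in>J. \<forall>b\<in>J. a + b \<in> J) \<and> (\<forall>s\<in>S. \<forall>a\<in>J. s * a \<in> J)"

definition adjoin :: "'a set \<Rightarrow> 'a \<Rightarrow> 'a set" where
  "adjoin J f = {j + f * s | j s. j \<in> J \<and> s \<in> S}"

primrec adjoin_list :: "'a set \<Rightarrow> 'a list \<Rightarrow> 'a set" where
  "adjoin_list J [] = J"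
| "adjoin_list J (f # fs) = adjoin_list (adjoin J f) fs"

definition regular_mod :: "'a set \<Rightarrow> 'a \<Rightarrow> bool" where
  "regular_mod J f \<longleftrightarrow> (\<forall>s\<in>S. f * s \<in> J \<longrightarrow> s \<in> J)"

text \<open>
  Regularity on the quotients of \<open>S/J\<close>, expressed by ideals: passing from \<open>M\<close> to \<open>M/fM\<close> replaces \<open>J\<close>
  by \<open>J + f S\<close>. In contrast to a regular sequence, the final quotient may vanish.
\<close>

primrec weakly_regular :: "'a set \<Rightarrow> 'a list \<Rightarrow> bool" where
  "weakly_regular J [] = True"
| "weakly_regular J (f # fs) = (regular_mod J f \<and> weakly_regular (adjoin J f) fs)"

text \<open>
  The \<open>y\<close>-adic topology on \<open>S/J\<close> is Hausdorff. This replaces Krull's intersection theorem, and it holds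
  for homogeneous \<open>J\<close> and a homogeneous \<open>y\<close> of positive degree.
\<close>

definition separated :: "'a set \<Rightarrow> 'a \<Rightarrow> bool" where
  "separated J y \<longleftrightarrow> (\<forall>u\<in>S. (\<forall>k. u \<in> adjoin J (y ^ k)) \<longrightarrow> u \<in> J)"

lemma ideal_subset: "is_ideal J \<Longrightarrow> a \<in> J \<Longrightarrow> a \<in> S"
  and ideal_zero: "is_ideal J \<Longrightarrow> 0 \<in> J"
  and ideal_add: "is_ideal J \<Longrightarrow> a \<in> J \<Longrightarrow> b \<in> J \<Longrightarrow> a + b \<in> J"
  and ideal_mult: "is_ideal J \<Longrightarrow> s \<in> S \<Longrightarrow> a \<in> J \<Longrightarrow> s * a \<in> J"
  unfolding is_ideal_def by auto

lemma ideal_mult_right: "is_ideal J \<Longrightarrow> s \<in> S \<Longrightarrow> a \<in> J \<Longrightarrow> a * s \<in> J"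
  using ideal_mult[of J s a] by (simp add: mult.commute)

lemma ideal_uminus: "is_ideal J \<Longrightarrow> a \<in> J \<Longrightarrow> - a \<in> J"
  using ideal_mult[of J "- 1" a] by (simp add: uminus_S one_S)

lemma ideal_diff: "is_ideal J \<Longrightarrow> a \<in> J \<Longrightarrow> b \<in> J \<Longrightarrow> a - b \<in> J"
  using ideal_add[of J a "- b"] ideal_uminus[of J b] by simp

lemma ideal_sum: "is_ideal J \<Longrightarrow> (\<And>i. i \<in> A \<Longrightarrow> g i \<in> J) \<Longrightarrow> sum g A \<in> J"
  by (induction A rule: infinite_finite_induct) (auto simp: ideal_zero ideal_add)

lemma ideal_add_iff: "is_ideal J \<Longrightarrow> a \<in> J \<Longrightarrow> a + b \<in> J \<longleftrightarrow> b \<in> J"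
  using ideal_add[of J a b] ideal_diff[of J "a + b" a] by auto

lemma adjoinI: "j \<in> J \<Longrightarrow> s \<in> S \<Longrightarrow> j + f * s \<in> adjoin J f"
  unfolding adjoin_def by blast

lemma adjoinE:
  assumes "a \<in> adjoin J f"
  obtains j s where "j \<in> J" "s \<in> S" "a = j + f * s"
  using assms unfolding adjoin_def by blast

lemma adjoin_iff: "a \<in> adjoin J f \<longleftrightarrow> (\<exists>s\<in>S. a - f * s \<in> J)"
proof
  assume "\<exists>s\<in>S. a - f * s \<in> J"
  then obtain s where "s \<in> S" "a - f * s \<in> J" by blast
  then show "a \<in> adjoin J f" using adjoinI[of "a - f * s" J s f] by simp
next
  assume "a \<in> adjoin J f"
  then obtain j s where "j \<in> J" "s \<in> S" "a = j + f * s" by (rule adjoinE)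
  then show "\<exists>s\<in>S. a - f * s \<in> J" by (intro bexI[of _ s]) auto
qed

lemma subset_adjoin: "J \<subseteq> adjoin J f"
  using adjoinI[OF _ zero_S, of _ J f] by auto

lemma ideal_adjoin:
  assumes J: "is_ideal J" and f: "f \<in> S"
  shows "is_ideal (adjoin J f)"
  unfolding is_ideal_def
proof (intro conjI ballI)
  show "adjoin J f \<subseteq> S"
    using J f by (auto elim!: adjoinE intro!: S_intros dest: ideal_subset)
  show "0 \<in> adjoin J f"
    using subset_adjoin ideal_zero[OF J] by blast
  fix a assume a: "a \<in> adjoin J f"
  then obtain j s where js: "j \<in> J" "s \<in> S" "a = j + f * s" by (rule adjoinE)
  { fix b assume "b \<in> adjoin J f"
    then obtain i t where "i \<in> J" "t \<in> S" "b = i + f * t" by (rule adjoinE)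
    then show "a + b \<in> adjoin J f"
      using adjoinI[of "j + i" J "s + t" f] js ideal_add[OF J] add_S by (simp add: algebra_simps) }
  fix r assume "r \<in> S"
  then show "r * a \<in> adjoin J f"
    using adjoinI[OF ideal_mult[OF J \<open>r \<in> S\<close> js(1)] mult_S[OF \<open>r \<in> S\<close> js(2)], of f] js(3)
    by (simp add: algebra_simps)
qed

lemma adjoin_commute: "adjoin (adjoin J f) g = adjoin (adjoin J g) f"
proof -
  have "adjoin (adjoin J f) g \<subseteq> adjoin (adjoin J g) f" for f g
    by (auto simp: adjoin_iff) (metis diff_diff_eq add.commute)
  then show ?thesis by blast
qed

lemma ideal_adjoin_list: "is_ideal J \<Longrightarrow> set fs \<subseteq> S \<Longrightarrow> is_ideal (adjoin_list J fs)"
  by (induction fs arbitrary: J) (auto simp: ideal_adjoin)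

lemma adjoin_list_snoc: "adjoin_list J (fs @ [g]) = adjoin (adjoin_list J fs) g"
  by (induction fs arbitrary: J) auto

lemma adjoin_list_least:
  "is_ideal L \<Longrightarrow> J \<subseteq> L \<Longrightarrow> set fs \<subseteq> L \<Longrightarrow> adjoin_list J fs \<subseteq> L"
proof (induction fs arbitrary: J)
  case (Cons f fs)
  have "adjoin J f \<subseteq> L"
    using Cons.prems by (auto elim!: adjoinE intro!: ideal_add[of L] ideal_mult_right[of L])
  then show ?case using Cons by auto
qed simp

lemma subset_adjoin_list: "J \<subseteq> adjoin_list J fs"
  by (induction fs arbitrary: J) (use subset_adjoin in force)+

lemma weakly_regular_append:
  "weakly_regular J (fs @ gs) \<longleftrightarrow> weakly_regular J fs \<and> weakly_regular (adjoin_list J fs) gs"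
  by (induction fs arbitrary: J) auto

lemma weakly_regular_iff_nth:
  "weakly_regular J fs \<longleftrightarrow> (\<forall>i<length fs. regular_mod (adjoin_list J (take i fs)) (fs ! i))"
  by (induction fs arbitrary: J) (auto simp: less_Suc_eq_0_disj)

lemma regular_modD: "regular_mod J f \<Longrightarrow> s \<in> S \<Longrightarrow> f * s \<in> J \<Longrightarrow> s \<in> J"
  unfolding regular_mod_def by blast

lemma regular_mod_mult:
  "f \<in> S \<Longrightarrow> g \<in> S \<Longrightarrow> regular_mod J f \<Longrightarrow> regular_mod J g \<Longrightarrow> regular_mod J (f * g)"
  unfolding regular_mod_def by (metis mult.assoc mult_S)

lemma regular_mod_prod:
  "(\<And>i. i \<in> A \<Longrightarrow> g i \<in> S \<and> regular_mod J (g i)) \<Longrightarrow> prod g A \<in> S \<and> regular_mod J (prod g A)"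
  by (induction A rule: infinite_finite_induct)
    (auto simp: one_S mult_S regular_mod_mult regular_mod_def[of J 1])

lemma regular_mod_power: "f \<in> S \<Longrightarrow> regular_mod J f \<Longrightarrow> regular_mod J (f ^ k)"
  by (induction k) (auto simp: regular_mod_mult power_S regular_mod_def[of J 1])

lemma regular_mod_cong:
  assumes "is_ideal J" "f - g \<in> J"
  shows "regular_mod J f \<longleftrightarrow> regular_mod J g"
proof -
  have "f * s \<in> J \<longleftrightarrow> g * s \<in> J" if "s \<in> S" for s
    using ideal_add_iff[OF assms(1) ideal_mult_right[OF assms(1) that assms(2)], of "g * s"]
    by (simp add: algebra_simps)
  then show ?thesis unfolding regular_mod_def by blast
qed

subsection \<open>Short exact sequences\<close>

definition colon :: "'a set \<Rightarrow> 'a \<Rightarrow> 'a set" where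
  "colon J v = {s \<in> S. v * s \<in> J}"

text \<open>
  For a short exact sequence \<open>0 \<rightarrow> M' \<rightarrow> M \<rightarrow> M'' \<rightarrow> 0\<close>, a nonzerodivisor \<open>f\<close> on \<open>M'\<close> and \<open>M''\<close> is one on \<open>M\<close>,
  and the sequence stays exact modulo \<open>f\<close>. Here \<open>M' = S/(J : v)\<close>, \<open>M = S/J\<close> and \<open>M'' = S/(J + v S)\<close>;
  exactness modulo \<open>f\<close> is the identity \<open>(J + f S) : v = (J : v) + f S\<close>.
\<close>

lemma weakly_regular_exact:
  assumes "is_ideal J" "v \<in> S" "set fs \<subseteq> S"
    and "weakly_regular (colon J v) fs" "weakly_regular (adjoin J v) fs"
  shows "weakly_regular J fs"
  using assms
proof (induction fs arbitrary: J)
  case (Cons f fs)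
  have f: "f \<in> S" and J: "is_ideal J" and v: "v \<in> S" using Cons.prems by auto
  have c: "regular_mod (colon J v) f" and a: "regular_mod (adjoin J v) f"
    using Cons.prems by auto
  have "regular_mod J f"
    unfolding regular_mod_def
  proof (intro ballI impI)
    fix u assume u: "u \<in> S" "f * u \<in> J"
    then have "u \<in> adjoin J v" using a subset_adjoin by (blast intro: regular_modD)
    then obtain j w where w: "j \<in> J" "w \<in> S" "u = j + v * w" by (rule adjoinE)
    have "v * (f * w) = f * u - f * j" using w by (simp add: algebra_simps)
    then have "f * w \<in> colon J v"
      unfolding colon_def using u w ideal_diff[OF J u(2) ideal_mult[OF J f w(1)]] f by (simp add: mult_S)
    then have "w \<in> colon J v" using c w by (blast intro: regular_modD)
    then show "u \<in> J" using w J by (auto simp: colon_def ideal_add)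
  qed
  moreover have "colon (adjoin J f) v = adjoin (colon J v) f"
  proof
    show "adjoin (colon J v) f \<subseteq> colon (adjoin J f) v"
    proof
      fix u assume "u \<in> adjoin (colon J v) f"
      then obtain j s where "j \<in> colon J v" "s \<in> S" "u = j + f * s" by (rule adjoinE)
      then show "u \<in> colon (adjoin J f) v"
        using adjoinI[of "v * j" J "v * s" f] f v
        by (auto simp: colon_def algebra_simps intro!: S_intros)
    qed
    show "colon (adjoin J f) v \<subseteq> adjoin (colon J v) f"
    proof
      fix u assume "u \<in> colon (adjoin J f) v"
      then have u: "u \<in> S" "v * u \<in> adjoin J f" by (auto simp: colon_def)
      from u(2) obtain i w where w: "i \<in> J" "w \<in> S" "v * u = i + f * w" by (rule adjoinE)
      have "f * w = - i + v * u" using w by simp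
      then have "f * w \<in> adjoin J v" using adjoinI[of "- i" J u v] ideal_uminus[OF J w(1)] u by simp
      then have "w \<in> adjoin J v" using a w by (blast intro: regular_modD)
      then obtain i' w' where w': "i' \<in> J" "w' \<in> S" "w = i' + v * w'" by (rule adjoinE)
      have "v * (u - f * w') = i + f * i'" using w w' by (simp add: algebra_simps)
      then have "u - f * w' \<in> colon J v"
        using u w' f ideal_add[OF J w(1) ideal_mult[OF J f w'(1)]] by (simp add: colon_def S_intros)
      then show "u \<in> adjoin (colon J v) f" using w' by (auto simp: adjoin_iff)
    qed
  qed
  moreover have "adjoin (adjoin J f) v = adjoin (adjoin J v) f" by (rule adjoin_commute)
  ultimately show ?case using Cons.IH[of "adjoin J f"] Cons.prems by (auto simp: ideal_adjoin)
qed simp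

subsection \<open>Permuting a weakly regular sequence\<close>

text \<open>
  If \<open>y u = f w\<close> modulo \<open>J\<close>, then \<open>f w\<close> vanishes modulo \<open>y\<close>, so \<open>w = y w'\<close> and \<open>u = f w'\<close>.
\<close>

lemma regular_mod_swap:
  assumes J: "is_ideal J" and S: "y \<in> S" "f \<in> S"
    and y: "regular_mod J y" and f: "regular_mod (adjoin J y) f"
  shows "regular_mod (adjoin J f) y"
  unfolding regular_mod_def
proof (intro ballI impI)
  fix u assume u: "u \<in> S" "y * u \<in> adjoin J f"
  from u(2) obtain j w where w: "j \<in> J" "w \<in> S" "y * u = j + f * w" by (rule adjoinE)
  have "f * w = - j + y * u" using w by simp
  then have "f * w \<in> adjoin J y" using adjoinI[of "- j" J u y] ideal_uminus[OF J w(1)] u by simp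
  then have "w \<in> adjoin J y" using f w by (blast intro: regular_modD)
  then obtain i w' where w': "i \<in> J" "w' \<in> S" "w = i + y * w'" by (rule adjoinE)
  have "y * (u - f * w') = j + f * i" using w w' by (simp add: algebra_simps)
  then have "u - f * w' \<in> J"
    using ideal_add[OF J w(1) ideal_mult[OF J S(2) w'(1)]] u w' S
    by (metis regular_modD[OF y] diff_S mult_S)
  then show "u \<in> adjoin J f" using w' by (auto simp: adjoin_iff)
qed

text \<open>
  The other half of exchanging \<open>y\<close> and \<open>f\<close>. If \<open>f u = 0\<close>, then \<open>u\<close> is divisible by \<open>y\<close> because \<open>f\<close> is regular
  modulo \<open>y\<close>, and the quotient is again killed by \<open>f\<close> because \<open>y\<close> is regular; so \<open>u\<close> is divisible by all
  powers of \<open>y\<close>.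
\<close>

lemma regular_mod_first:
  assumes J: "is_ideal J" and S: "y \<in> S" "f \<in> S"
    and y: "regular_mod J y" and f: "regular_mod (adjoin J y) f" and sep: "separated J y"
  shows "regular_mod J f"
  unfolding regular_mod_def
proof (intro ballI impI)
  fix u assume u: "u \<in> S" "f * u \<in> J"
  have "u \<in> adjoin J (y ^ k)" for k
  proof (induction k)
    case 0
    show ?case using u J by (auto simp: adjoin_iff intro!: bexI[of _ u] ideal_zero)
  next
    case (Suc k)
    then obtain j w where w: "j \<in> J" "w \<in> S" "u = j + y ^ k * w" by (rule adjoinE)
    have "y ^ k * (f * w) = f * u - f * j" using w by (simp add: algebra_simps)
    then have "y ^ k * (f * w) \<in> J" using ideal_diff[OF J u(2) ideal_mult[OF J S(2) w(1)]] by simp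
    then have "f * w \<in> J"
      using regular_modD[OF regular_mod_power[OF S(1) y]] S w by (simp add: mult_S)
    then have "w \<in> adjoin J y" using f w subset_adjoin by (blast intro: regular_modD)
    then obtain i w' where w': "i \<in> J" "w' \<in> S" "w = i + y * w'" by (rule adjoinE)
    have "u = (j + y ^ k * i) + y ^ Suc k * w'" using w w' by (simp add: algebra_simps)
    then show ?case using adjoinI w w' ideal_add[OF J w(1) ideal_mult[OF J _ w'(1)]] S power_S by metis
  qed
  then show "u \<in> J" using sep u unfolding separated_def by blast
qed

lemma weakly_regular_rotate:
  assumes "is_ideal J" "y \<in> S" "set fs \<subseteq> S" "weakly_regular J (y # fs)"
    and "\<And>i. i < length fs \<Longrightarrow> separated (adjoin_list J (take i fs)) y"
  shows "weakly_regular J (fs @ [y])"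
  using assms
proof (induction fs arbitrary: J)
  case (Cons f fs)
  have "separated J y" using Cons.prems(5)[of 0] by simp
  then have "regular_mod J f" using regular_mod_first[of J y f] Cons.prems by auto
  moreover have "regular_mod (adjoin J f) y" using regular_mod_swap[of J y f] Cons.prems by auto
  moreover have "separated (adjoin_list (adjoin J f) (take i fs)) y" if "i < length fs" for i
    using Cons.prems(5)[of "Suc i"] that by simp
  ultimately show ?case
    using Cons.IH[of "adjoin J f"] Cons.prems by (auto simp: ideal_adjoin adjoin_commute[of J f y])
qed simp

subsection \<open>Powers and independence of monomials\<close>

text \<open>
  The induction moves \<open>h\<close> in front of \<open>f\<close>, \<open>g\<close> and \<open>f * g\<close> and absorbs it into \<open>J\<close>; what remains
  is that \<open>h\<close> is regular modulo \<open>f * g\<close>.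
\<close>

lemma weakly_regular_mult_head:
  assumes "is_ideal J" "f \<in> S" "g \<in> S" "set hs \<subseteq> S"
    and "weakly_regular J (f # hs)" "weakly_regular J (g # hs)"
  shows "weakly_regular J (f * g # hs)"
  using assms
proof (induction hs arbitrary: J)
  case (Cons h hs)
  have J: "is_ideal J" and S: "f \<in> S" "g \<in> S" "h \<in> S" using Cons.prems by auto
  have fr: "regular_mod J f" "regular_mod J g" and
    hr: "regular_mod (adjoin J f) h" "regular_mod (adjoin J g) h" using Cons.prems by auto
  have "weakly_regular (adjoin J h) (f * g # hs)"
    using Cons.prems regular_mod_swap[OF J S(1,3) fr(1) hr(1)] regular_mod_swap[OF J S(2,3) fr(2) hr(2)]
    by (intro Cons.IH) (auto simp: ideal_adjoin adjoin_commute[of J h])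
  moreover have "regular_mod (adjoin J (f * g)) h"
    unfolding regular_mod_def
  proof (intro ballI impI)
    fix u assume u: "u \<in> S" "h * u \<in> adjoin J (f * g)"
    from u(2) obtain j w where w: "j \<in> J" "w \<in> S" "h * u = j + f * g * w" by (rule adjoinE)
    then have "h * u \<in> adjoin J f" using adjoinI[of j J "g * w" f] S by (simp add: mult_S mult.assoc)
    then have "u \<in> adjoin J f" using hr u by (blast intro: regular_modD)
    then obtain i z where z: "i \<in> J" "z \<in> S" "u = i + f * z" by (rule adjoinE)
    have "f * (h * z - g * w) = j - h * i" using w z by (simp add: algebra_simps)
    then have "h * z - g * w \<in> J"
      using ideal_diff[OF J w(1) ideal_mult[OF J S(3) z(1)]] S w z
      by (metis regular_modD[OF fr(1)] diff_S mult_S)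
    then have "h * z \<in> adjoin J g" using w by (auto simp: adjoin_iff)
    then have "z \<in> adjoin J g" using hr z by (blast intro: regular_modD)
    then obtain i' z' where z': "i' \<in> J" "z' \<in> S" "z = i' + g * z'" by (rule adjoinE)
    have "u = (i + f * i') + f * g * z'" using z z' by (simp add: algebra_simps)
    then show "u \<in> adjoin J (f * g)"
      using adjoinI z z' ideal_add[OF J z(1) ideal_mult[OF J S(1) z'(1)]] by metis
  qed
  ultimately show ?case using regular_mod_mult[OF S(1,2) fr] by (simp add: adjoin_commute[of J h])
qed (simp add: regular_mod_mult)

lemma weakly_regular_whole:
  assumes "set fs \<subseteq> S"
  shows "weakly_regular S fs"
proof -
  have i: "is_ideal S" by (auto simp: is_ideal_def S_intros)
  have "adjoin S f = S" if "f \<in> S" for f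
    using subset_adjoin[of S f] ideal_adjoin[OF i that] by (auto simp: is_ideal_def)
  then show ?thesis
    using assms by (induction fs) (auto simp: regular_mod_def)
qed

lemma weakly_regular_power_head:
  assumes "is_ideal J" "f \<in> S" "set hs \<subseteq> S" "weakly_regular J (f # hs)"
  shows "weakly_regular J (f ^ k # hs)"
proof (induction k)
  case 0
  have "adjoin J 1 = S"
    using ideal_adjoin[OF assms(1) one_S] adjoinI[of 0 J _ 1] ideal_zero[OF assms(1)]
    by (auto simp: is_ideal_def)
  then show ?case using weakly_regular_whole assms(3) by (simp add: regular_mod_def)
next
  case (Suc k)
  then show ?case using weakly_regular_mult_head[of J f "f ^ k" hs] assms by (simp add: power_S)
qed

lemma weakly_regular_powers:
  assumes "is_ideal J" "set fs \<subseteq> S" "weakly_regular J fs"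
  shows "weakly_regular J (map (\<lambda>f. f ^ k) fs)"
  using assms
proof (induction fs arbitrary: J)
  case (Cons f fs)
  then have "weakly_regular J (f ^ k # fs)" using weakly_regular_power_head by auto
  then show ?case using Cons.IH[of "adjoin J (f ^ k)"] Cons.prems by (auto simp: ideal_adjoin power_S)
qed simp

definition list_monomial :: "'a list \<Rightarrow> nat list \<Rightarrow> 'a" where
  "list_monomial gs as = prod_list (map2 (^) gs as)"

lemma list_monomial_S: "set gs \<subseteq> S \<Longrightarrow> list_monomial gs as \<in> S"
  unfolding list_monomial_def
proof (induction gs arbitrary: as)
  case (Cons g gs)
  then show ?case by (cases as) (auto simp: S_intros)
qed (simp add: one_S)

lemma list_monomial_Cons: "list_monomial (g # gs) (a # as) = g ^ a * list_monomial gs as"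
  by (simp add: list_monomial_def)

text \<open>
  For \<open>x\<close> outside \<open>J + (g\<^sub>1, \<dots>, g\<^sub>r)\<close> and a sequence weakly regular modulo \<open>J\<close> the products \<open>g\<^sup>a x\<close> are independent modulo \<open>J\<close>
  over a field of constants. In a relation with nonzero coefficients, cancel the largest common power
  of \<open>g\<^sub>1\<close>, which is allowed as \<open>g\<^sub>1\<close> is regular. The terms without \<open>g\<^sub>1\<close> that appear then satisfy a relation modulo
  \<open>J + g\<^sub>1 S\<close>, where induction applies; at the end a unit times \<open>x\<close> would lie in \<open>J + (g\<^sub>1, \<dots>, g\<^sub>r)\<close>.
\<close>

lemma weakly_regular_independent:
  assumes "is_ideal J" "set gs \<subseteq> S" "weakly_regular J gs" "x \<in> S" "x \<notin> adjoin_list J gs"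
    and "finite F" "\<And>as. as \<in> F \<Longrightarrow> length as = length gs"
    and "\<And>as. as \<in> F \<Longrightarrow> c as \<in> S \<and> (\<exists>d\<in>S. d * c as = 1)"
    and "(\<Sum>as\<in>F. c as * list_monomial gs as * x) \<in> J"
  shows "F = {}"
  using assms
proof (induction gs arbitrary: J F c)
  case Nil
  show ?case
  proof (rule ccontr)
    assume "F \<noteq> {}"
    then have F: "F = {[]}" using Nil.prems(7) by auto
    then have m: "c [] * x \<in> J" using Nil.prems(9) by (simp add: list_monomial_def)
    obtain d where d: "d \<in> S" "d * c [] = 1" using Nil.prems(8) F by auto
    have "d * (c [] * x) \<in> J" using ideal_mult Nil.prems(1) d(1) m by blast
    then have "x \<in> J" using d by (simp add: mult.assoc[symmetric])
    then show False using Nil.prems by simp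
  qed
next
  case (Cons g gs)
  have J: "is_ideal J" and g: "g \<in> S" "set gs \<subseteq> S" and r: "regular_mod J g" and x: "x \<in> S"
    using Cons.prems by auto
  show ?case
  proof (rule ccontr)
    assume ne: "F \<noteq> {}"
    have len: "\<exists>a as'. as = a # as' \<and> length as' = length gs" if "as \<in> F" for as
      using Cons.prems(7)[OF that] by (cases as) auto
    \<comment> \<open>\<open>g ^ m\<close> is the largest power of \<open>g\<close> dividing every term.\<close>
    define m where "m = Min (hd ` F)"
    have m: "m \<in> hd ` F" "\<And>as. as \<in> F \<Longrightarrow> m \<le> hd as"
      unfolding m_def using Cons.prems(6) ne by auto
    define q where "q as = c as * list_monomial gs (tl as) * x" for as
    have qS: "q as \<in> S" if "as \<in> F" for as
      unfolding q_def using Cons.prems(8)[OF that] x g by (auto intro!: S_intros list_monomial_S)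
    have "(\<Sum>as\<in>F. c as * list_monomial (g # gs) as * x) = (\<Sum>as\<in>F. g ^ m * (g ^ (hd as - m) * q as))"
    proof (rule sum.cong)
      fix as assume as: "as \<in> F"
      then obtain a as' where a: "as = a # as'" using len by blast
      have "g ^ a = g ^ m * g ^ (a - m)" using m(2)[OF as] a by (simp flip: power_add)
      then show "c as * list_monomial (g # gs) as * x = g ^ m * (g ^ (hd as - m) * q as)"
        by (simp add: a q_def list_monomial_Cons algebra_simps)
    qed simp
    then have "g ^ m * (\<Sum>as\<in>F. g ^ (hd as - m) * q as) \<in> J"
      using Cons.prems(9) by (simp add: sum_distrib_left)
    then have s: "(\<Sum>as\<in>F. g ^ (hd as - m) * q as) \<in> J"
      by (rule regular_modD[OF regular_mod_power[OF g(1) r], rotated])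
        (use qS g in \<open>auto intro!: sum_S mult_S power_S\<close>)
    \<comment> \<open>The terms that survive modulo \<open>g\<close>; there is at least one by the choice of \<open>m\<close>.\<close>
    define F' where "F' = {as \<in> F. hd as = m}"
    have ideal': "is_ideal (adjoin J g)" using ideal_adjoin[OF J g(1)] .
    have "(\<Sum>as\<in>F - F'. g ^ (hd as - m) * q as) \<in> adjoin J g"
    proof (rule ideal_sum[OF ideal'])
      fix as assume as: "as \<in> F - F'"
      then have "hd as - m = Suc (hd as - m - 1)" using m(2)[of as] unfolding F'_def by auto
      then have "g ^ (hd as - m) * q as = 0 + g * (g ^ (hd as - m - 1) * q as)"
        by (metis add_0 mult.assoc power_Suc)
      then show "g ^ (hd as - m) * q as \<in> adjoin J g"
        using adjoinI[OF ideal_zero[OF J], of "g ^ (hd as - m - 1) * q as" g] qS as g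
        by (auto intro: S_intros)
    qed
    moreover have "(\<Sum>as\<in>F - F'. g ^ (hd as - m) * q as) + (\<Sum>as\<in>F'. q as)
        = (\<Sum>as\<in>F. g ^ (hd as - m) * q as)"
      using sum.subset_diff[of F' F "\<lambda>as. g ^ (hd as - m) * q as"] Cons.prems(6)
      by (auto simp: F'_def intro!: sum.cong)
    ultimately have "(\<Sum>as\<in>F'. q as) \<in> adjoin J g"
      using ideal_add_iff[OF ideal', of _ "\<Sum>as\<in>F'. q as"] subsetD[OF subset_adjoin s, of g] by metis
    moreover have "(\<Sum>as\<in>F'. q as) = (\<Sum>bs\<in>tl ` F'. c (m # bs) * list_monomial gs bs * x)"
    proof (subst sum.reindex)
      show "inj_on tl F'"
        by (rule inj_onI) (metis (mono_tags, lifting) F'_def len list.sel mem_Collect_eq)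
      show "sum q F' = sum ((\<lambda>bs. c (m # bs) * list_monomial gs bs * x) \<circ> tl) F'"
      proof (rule sum.cong)
        fix as assume as: "as \<in> F'"
        then have "m # tl as = as" using len[of as] unfolding F'_def by auto
        then show "q as = ((\<lambda>bs. c (m # bs) * list_monomial gs bs * x) \<circ> tl) as"
          by (simp add: q_def)
      qed simp
    qed
    ultimately have s': "(\<Sum>bs\<in>tl ` F'. c (m # bs) * list_monomial gs bs * x) \<in> adjoin J g"
      by simp
    have mem: "m # bs \<in> F \<and> length bs = length gs" if "bs \<in> tl ` F'" for bs
      using that len unfolding F'_def by fastforce
    have "tl ` F' = {}"
    proof (rule Cons.IH[OF ideal' g(2) _ x _ _ _ _ s'])
      show "weakly_regular (adjoin J g) gs" "x \<notin> adjoin_list (adjoin J g) gs"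
        using Cons.prems by auto
      show "finite (tl ` F')" using Cons.prems(6) by (simp add: F'_def)
      show "length bs = length gs" if "bs \<in> tl ` F'" for bs using mem that by blast
      show "c (m # bs) \<in> S \<and> (\<exists>d\<in>S. d * c (m # bs) = 1)" if "bs \<in> tl ` F'" for bs
        using mem that Cons.prems(8) by blast
    qed
    then show False using m(1) unfolding F'_def by auto
  qed
qed

end

section \<open>Monomials and coefficients\<close>

abbreviation supp :: "('v \<Rightarrow>\<^sub>0 nat) \<Rightarrow> 'v set" where
  "supp e \<equiv> Poly_Mapping.keys e"

abbreviation coeff :: "('v, 'k::zero) mpol \<Rightarrow> ('v \<Rightarrow>\<^sub>0 nat) \<Rightarrow> 'k" where
  "coeff p e \<equiv> Poly_Mapping.lookup p e"

abbreviation monomials :: "('v, 'k::zero) mpol \<Rightarrow> ('v \<Rightarrow>\<^sub>0 nat) set" where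
  "monomials p \<equiv> Poly_Mapping.keys p"

abbreviation monom :: "('v \<Rightarrow>\<^sub>0 nat) \<Rightarrow> 'k::zero \<Rightarrow> ('v, 'k) mpol" where
  "monom e c \<equiv> Poly_Mapping.single e c"

lemma supp_add: "supp (a + b) = supp a \<union> supp b"
  by (auto simp: in_keys_iff lookup_add)

lemma monomials_sum: "monomials (sum g A) \<subseteq> (\<Union>i\<in>A. monomials (g i))"
proof (induction A rule: infinite_finite_induct)
  case (insert x F)
  then show ?case using Poly_Mapping.keys_add[of "g x" "sum g F"] by auto
qed auto

lemma sum_monom: "(\<Sum>e\<in>monomials p. monom e (coeff p e)) = p"
proof (rule poly_mapping_eqI)
  fix k
  show "coeff (\<Sum>e\<in>monomials p. monom e (coeff p e)) k = coeff p k"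
    by (simp add: lookup_sum lookup_single when_def in_keys_iff)
qed

definition poly_restrict :: "(('v \<Rightarrow>\<^sub>0 nat) \<Rightarrow> bool) \<Rightarrow> ('v, 'k::comm_monoid_add) mpol \<Rightarrow> ('v, 'k) mpol" where
  "poly_restrict P p = (\<Sum>e\<in>{e \<in> monomials p. P e}. monom e (coeff p e))"

lemma coeff_restrict: "coeff (poly_restrict P p) e = (if P e then coeff p e else 0)"
  by (simp add: poly_restrict_def lookup_sum lookup_single when_def in_keys_iff)

lemma monomials_restrict: "monomials (poly_restrict P p) = {e \<in> monomials p. P e}"
  by (auto simp: in_keys_iff coeff_restrict split: if_splits)

lemma restrict_add: "poly_restrict P (p + q) = poly_restrict P p + poly_restrict P q"
  by (rule poly_mapping_eqI) (simp add: coeff_restrict lookup_add)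

lemma coeff_monom_times:
  fixes p :: "('v, 'k::semiring_0) mpol"
  shows "coeff (monom a c * p) (a + b) = c * coeff p b"
proof -
  have "(coeff (monom a c) l * (\<Sum>q. coeff p q when a + b = l + q)) =
        ((c * (\<Sum>q. coeff p q when b = q)) when l = a)" for l
    by (auto simp: lookup_single when_def)
  then show ?thesis by (simp add: lookup_mult)
qed

lemma monomials_monom_times:
  fixes p :: "('v, 'k::field) mpol"
  assumes "c \<noteq> 0"
  shows "monomials (monom a c * p) = (+) a ` monomials p"
proof
  show "monomials (monom a c * p) \<subseteq> (+) a ` monomials p"
    using keys_mult[of "monom a c" p] assms by auto
  show "(+) a ` monomials p \<subseteq> monomials (monom a c * p)"
    using assms by (auto simp: in_keys_iff coeff_monom_times)
qed

lemma divide_by_monom: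
  fixes p :: "('v, 'k::field) mpol"
  assumes "\<And>e. e \<in> monomials p \<Longrightarrow> \<exists>e'. e = a + e'"
  obtains s where "p = monom a 1 * s" "\<And>e. e \<in> monomials s \<Longrightarrow> a + e \<in> monomials p"
proof
  define s where "s = (\<Sum>e\<in>monomials p. monom (e - a) (coeff p e))"
  have "monom a 1 * s = (\<Sum>e\<in>monomials p. monom e (coeff p e))"
    unfolding s_def sum_distrib_left
    by (rule sum.cong) (use assms in \<open>fastforce simp: mult_single\<close>)+
  then show p: "p = monom a 1 * s" by (simp add: sum_monom)
  show "a + e \<in> monomials p" if "e \<in> monomials s" for e
    using that by (simp add: p monomials_monom_times)
qed

definition polys :: "'v set \<Rightarrow> ('v, 'k::field) mpol set" where
  "polys V = {p. \<forall>e\<in>monomials p. supp e \<subseteq> V}"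

lemma monomials_mult_subset:
  fixes p q :: "('v, 'k::field) mpol"
  shows "e \<in> monomials (p * q) \<Longrightarrow> \<exists>a\<in>monomials p. \<exists>b\<in>monomials q. e = a + b"
  using keys_mult[of p q] by blast

interpretation poly: ambient_subring "polys V :: ('v, 'k::field) mpol set" for V
proof
  show "(1 :: ('v, 'k) mpol) \<in> polys V" by (simp add: polys_def)
  fix a b :: "('v, 'k) mpol"
  assume a: "a \<in> polys V"
  then show "- a \<in> polys V" by (simp add: polys_def in_keys_iff)
  assume b: "b \<in> polys V"
  show "a + b \<in> polys V" using a b Poly_Mapping.keys_add[of a b] by (auto simp: polys_def)
  show "a * b \<in> polys V" using a b
    by (fastforce simp: polys_def supp_add dest!: monomials_mult_subset)
qed

lemma monom_polys: "supp e \<subseteq> V \<Longrightarrow> monom e c \<in> polys V"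
  by (auto simp: polys_def)

lemma mvar_polys: "v \<in> V \<Longrightarrow> mvar v \<in> polys V"
  unfolding mvar_def by (rule monom_polys) simp

section \<open>Stanley--Reisner ideals\<close>

definition down_closed :: "'v set set \<Rightarrow> bool" where
  "down_closed \<Delta> \<longleftrightarrow> (\<forall>F\<in>\<Delta>. \<forall>F'\<subseteq>F. F' \<in> \<Delta>)"

definition sr_ideal :: "'v set \<Rightarrow> 'v set set \<Rightarrow> ('v, 'k::field) mpol set" where
  "sr_ideal V \<Delta> = {p \<in> polys V. \<forall>e\<in>monomials p. supp e \<notin> \<Delta>}"

definition deletion :: "'v \<Rightarrow> 'v set set \<Rightarrow> 'v set set" where
  "deletion v \<Delta> = {F \<in> \<Delta>. v \<notin> F}"

definition star :: "'v \<Rightarrow> 'v set set \<Rightarrow> 'v set set" where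
  "star v \<Delta> = {F \<in> \<Delta>. insert v F \<in> \<Delta>}"

lemma down_closedD: "down_closed \<Delta> \<Longrightarrow> F \<in> \<Delta> \<Longrightarrow> F' \<subseteq> F \<Longrightarrow> F' \<in> \<Delta>"
  unfolding down_closed_def by blast

lemma down_closed_deletion: "down_closed \<Delta> \<Longrightarrow> down_closed (deletion v \<Delta>)"
  unfolding down_closed_def deletion_def by blast

lemma down_closed_star: "down_closed \<Delta> \<Longrightarrow> down_closed (star v \<Delta>)"
  unfolding down_closed_def star_def by (auto; meson insert_mono)

lemma ideal_sr:
  assumes "down_closed \<Delta>"
  shows "poly.is_ideal V (sr_ideal V \<Delta> :: ('v, 'k::field) mpol set)"
  unfolding poly.is_ideal_def
proof (intro conjI ballI)
  show "sr_ideal V \<Delta> \<subseteq> polys V" "0 \<in> sr_ideal V \<Delta>"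
    by (auto simp: sr_ideal_def poly.zero_S)
  fix a b :: "('v, 'k) mpol"
  assume a: "a \<in> sr_ideal V \<Delta>"
  { assume "b \<in> sr_ideal V \<Delta>"
    then show "a + b \<in> sr_ideal V \<Delta>"
      using a Poly_Mapping.keys_add[of a b] by (auto simp: sr_ideal_def poly.add_S) }
  assume b: "b \<in> polys V"
  have "supp e \<notin> \<Delta>" if e: "e \<in> monomials (b * a)" for e
  proof -
    obtain i j where "i \<in> monomials b" "j \<in> monomials a" "e = i + j"
      using monomials_mult_subset[OF e] by blast
    then show ?thesis using a down_closedD[OF assms, of "supp e" "supp j"]
      by (auto simp: sr_ideal_def supp_add)
  qed
  then show "b * a \<in> sr_ideal V \<Delta>" using a b by (auto simp: sr_ideal_def poly.mult_S)
qed

text \<open>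
  The monomials \<open>e\<close> with \<open>x\<^sub>v e \<notin> I\<close> are those whose support can be extended by \<open>v\<close> within \<open>\<Delta>\<close>.
\<close>

lemma sr_colon:
  assumes "down_closed \<Delta>" "v \<in> V"
  shows "poly.colon V (sr_ideal V \<Delta>) (mvar v) = (sr_ideal V (star v \<Delta>) :: ('v, 'k::field) mpol set)"
proof -
  have "mvar v * s \<in> sr_ideal V \<Delta> \<longleftrightarrow> (\<forall>e\<in>monomials s. supp e \<notin> star v \<Delta>)"
    if "s \<in> polys V" for s :: "('v, 'k) mpol"
  proof -
    have "monomials (mvar v * s) = (+) (Poly_Mapping.single v 1) ` monomials s"
      unfolding mvar_def by (rule monomials_monom_times) simp
    moreover have "insert v (supp e) \<in> \<Delta> \<longleftrightarrow> supp e \<in> star v \<Delta>" for e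
      using down_closedD[OF assms(1), of "insert v (supp e)" "supp e"] by (auto simp: star_def)
    ultimately show ?thesis
      using poly.mult_S[OF mvar_polys[OF assms(2)] that] by (simp add: sr_ideal_def supp_add)
  qed
  then show ?thesis unfolding poly.colon_def sr_ideal_def[of V "star v \<Delta>"] by blast
qed

text \<open>
  Modulo \<open>x\<^sub>v\<close> only the faces avoiding \<open>v\<close> survive: the terms of a polynomial divisible by \<open>x\<^sub>v\<close> form a
  multiple of \<open>x\<^sub>v\<close>, and the others have supports without \<open>v\<close>.
\<close>

lemma sr_adjoin:
  assumes "down_closed \<Delta>" "v \<in> V"
  shows "poly.adjoin V (sr_ideal V \<Delta>) (mvar v) = (sr_ideal V (deletion v \<Delta>) :: ('v, 'k::field) mpol set)"
proof
  have v: "(mvar v :: ('v, 'k) mpol) \<in> polys V" by (rule mvar_polys[OF assms(2)])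
  show "poly.adjoin V (sr_ideal V \<Delta>) (mvar v) \<subseteq> (sr_ideal V (deletion v \<Delta>) :: ('v, 'k) mpol set)"
  proof
    fix p :: "('v, 'k) mpol" assume "p \<in> poly.adjoin V (sr_ideal V \<Delta>) (mvar v)"
    then obtain j s where p: "j \<in> sr_ideal V \<Delta>" "s \<in> polys V" "p = j + mvar v * s"
      by (rule poly.adjoinE)
    have "mvar v * s \<in> sr_ideal V (deletion v \<Delta>)"
      using poly.mult_S[OF v p(2)] monomials_monom_times[of 1 "Poly_Mapping.single v 1" s]
      by (simp add: sr_ideal_def deletion_def mvar_def supp_add)
    moreover have "j \<in> sr_ideal V (deletion v \<Delta>)" using p by (auto simp: sr_ideal_def deletion_def)
    ultimately show "p \<in> sr_ideal V (deletion v \<Delta>)"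
      using poly.ideal_add[OF ideal_sr[OF down_closed_deletion[OF assms(1)]]] p(3) by blast
  qed
  show "(sr_ideal V (deletion v \<Delta>) :: ('v, 'k) mpol set) \<subseteq> poly.adjoin V (sr_ideal V \<Delta>) (mvar v)"
  proof
    fix p :: "('v, 'k) mpol" assume p: "p \<in> sr_ideal V (deletion v \<Delta>)"
    define j where "j = poly_restrict (\<lambda>e. v \<notin> supp e) p"
    define q where "q = poly_restrict (\<lambda>e. v \<in> supp e) p"
    have jq: "p = j + q" by (rule poly_mapping_eqI) (simp add: j_def q_def coeff_restrict lookup_add)
    have "\<exists>e'. e = Poly_Mapping.single v 1 + e'" if "e \<in> monomials q" for e
    proof
      show "e = Poly_Mapping.single v 1 + (e - Poly_Mapping.single v 1)"
        using that by (intro poly_mapping_eqI)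
          (auto simp: q_def monomials_restrict lookup_add lookup_minus lookup_single when_def in_keys_iff)
    qed
    then obtain s where s: "q = mvar v * s" "\<And>e. e \<in> monomials s \<Longrightarrow> Poly_Mapping.single v 1 + e \<in> monomials q"
      using divide_by_monom[of q "Poly_Mapping.single v 1"] unfolding mvar_def by metis
    have "s \<in> polys V"
      using p s(2) by (fastforce simp: polys_def sr_ideal_def q_def monomials_restrict supp_add)
    moreover have "j \<in> sr_ideal V \<Delta>"
      using p by (auto simp: sr_ideal_def j_def polys_def monomials_restrict deletion_def)
    ultimately show "p \<in> poly.adjoin V (sr_ideal V \<Delta>) (mvar v)"
      using jq s(1) poly.adjoinI by blast
  qed
qed

section \<open>Total degree\<close>

definition total_degree :: "('v \<Rightarrow>\<^sub>0 nat) \<Rightarrow> nat" where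
  "total_degree e = (\<Sum>v\<in>supp e. Poly_Mapping.lookup e v)"

lemma total_degree_superset:
  "finite A \<Longrightarrow> supp e \<subseteq> A \<Longrightarrow> total_degree e = (\<Sum>v\<in>A. Poly_Mapping.lookup e v)"
  unfolding total_degree_def by (rule sum.mono_neutral_left) (auto simp: in_keys_iff)

lemma total_degree_add: "total_degree (a + b) = total_degree a + total_degree b"
  using total_degree_superset[of "supp a \<union> supp b" a] total_degree_superset[of "supp a \<union> supp b" b]
    total_degree_superset[of "supp a \<union> supp b" "a + b"]
  by (simp add: supp_add lookup_add sum.distrib)

lemma lookup_le_total_degree: "Poly_Mapping.lookup e v \<le> total_degree e"
  unfolding total_degree_def by (cases "v \<in> supp e") (auto simp: member_le_sum in_keys_iff)

definition homogeneous :: "nat \<Rightarrow> ('v, 'k::zero) mpol \<Rightarrow> bool" where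
  "homogeneous d p \<longleftrightarrow> (\<forall>e\<in>monomials p. total_degree e = d)"

definition graded :: "('v, 'k::comm_monoid_add) mpol set \<Rightarrow> bool" where
  "graded J \<longleftrightarrow> (\<forall>p\<in>J. \<forall>d. poly_restrict (\<lambda>e. total_degree e = d) p \<in> J)"

lemma homogeneous_power: "homogeneous 1 (y :: ('v, 'k::field) mpol) \<Longrightarrow> homogeneous k (y ^ k)"
proof (induction k)
  case 0
  then show ?case by (simp add: homogeneous_def total_degree_def)
next
  case (Suc k)
  then show ?case
    by (fastforce simp: homogeneous_def total_degree_add dest!: monomials_mult_subset)
qed

text \<open>
  Multiplication by \<open>f\<close> shifts degrees by \<open>i\<close>. The condition \<open>i + total_degree e = d\<close> also gives the right
  answer \<open>0\<close> when \<open>d < i\<close>, where a natural number \<open>d - i\<close> would not.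
\<close>

lemma restrict_homogeneous_mult:
  fixes f s :: "('v, 'k::field) mpol"
  assumes f: "homogeneous i f"
  shows "poly_restrict (\<lambda>e. total_degree e = d) (f * s)
       = f * poly_restrict (\<lambda>e. i + total_degree e = d) s"
proof (rule poly_mapping_eqI)
  fix k
  have "coeff f l * (\<Sum>q. coeff (poly_restrict (\<lambda>e. i + total_degree e = d) s) q when k = l + q)
      = (if total_degree k = d then coeff f l * (\<Sum>q. coeff s q when k = l + q) else 0)" for l
  proof (cases "coeff f l = 0")
    case False
    then have l: "total_degree l = i" using f by (simp add: homogeneous_def in_keys_iff)
    have "(coeff (poly_restrict (\<lambda>e. i + total_degree e = d) s) q when k = l + q)
        = (if total_degree k = d then (coeff s q when k = l + q) else 0)" for q
      using l by (auto simp: coeff_restrict when_def total_degree_add)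
    then show ?thesis by simp
  qed simp
  then show "coeff (poly_restrict (\<lambda>e. total_degree e = d) (f * s)) k
      = coeff (f * poly_restrict (\<lambda>e. i + total_degree e = d) s) k"
    by (simp add: coeff_restrict lookup_mult)
qed

lemma restrict_polys: "p \<in> polys V \<Longrightarrow> poly_restrict P p \<in> polys V"
  by (simp add: polys_def monomials_restrict)

lemma graded_sr: "graded (sr_ideal V \<Delta>)"
  by (auto simp: graded_def sr_ideal_def monomials_restrict restrict_polys)

lemma graded_adjoin:
  fixes f :: "('v, 'k::field) mpol"
  assumes "graded J" "homogeneous i f"
  shows "graded (poly.adjoin V J f)"
  unfolding graded_def
proof (intro ballI allI)
  fix p d assume "p \<in> poly.adjoin V J f"
  then obtain j s where "j \<in> J" "s \<in> polys V" "p = j + f * s" by (rule poly.adjoinE)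
  then show "poly_restrict (\<lambda>e. total_degree e = d) p \<in> poly.adjoin V J f"
    using assms by (auto simp: restrict_add restrict_homogeneous_mult[OF assms(2)] graded_def restrict_polys
        intro!: poly.adjoinI)
qed

lemma graded_adjoin_list:
  fixes fs :: "('v, 'k::field) mpol list"
  shows "graded J \<Longrightarrow> (\<And>f. f \<in> set fs \<Longrightarrow> \<exists>i. homogeneous i f) \<Longrightarrow> graded (poly.adjoin_list V J fs)"
proof (induction fs arbitrary: J)
  case (Cons f fs)
  then obtain i where "homogeneous i f" by fastforce
  then show ?case using Cons graded_adjoin by fastforce
qed simp

text \<open>
  If \<open>u\<close> lies in \<open>J + y\<^sup>k S\<close> for a \<open>k\<close> above the degree of \<open>u\<close>, then comparing homogeneous components below
  degree \<open>k\<close> shows that every component of \<open>u\<close> lies in \<open>J\<close>.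
\<close>

lemma graded_separated:
  fixes y :: "('v, 'k::field) mpol"
  assumes J: "poly.is_ideal V J" "graded J" and y: "homogeneous 1 y"
  shows "poly.separated V J y"
  unfolding poly.separated_def
proof (intro ballI impI)
  fix u assume u: "u \<in> polys V" "\<forall>k. u \<in> poly.adjoin V J (y ^ k)"
  obtain k where k: "\<And>e. e \<in> monomials u \<Longrightarrow> total_degree e < k"
    using finite_nat_set_iff_bounded[of "total_degree ` monomials u"] by auto
  obtain j s where js: "j \<in> J" "s \<in> polys V" "u = j + y ^ k * s"
    using u(2) by (meson poly.adjoinE)
  have "poly_restrict (\<lambda>e. total_degree e = d) u \<in> J" if "d < k" for d
  proof -
    have "poly_restrict (\<lambda>e. k + total_degree e = d) s = 0"
      using that by (intro poly_mapping_eqI) (auto simp: coeff_restrict)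
    then have "poly_restrict (\<lambda>e. total_degree e = d) u = poly_restrict (\<lambda>e. total_degree e = d) j"
      using js(3) by (simp add: restrict_add restrict_homogeneous_mult[OF homogeneous_power[OF y]])
    then show ?thesis using J(2) js(1) by (simp add: graded_def)
  qed
  then have "(\<Sum>d<k. poly_restrict (\<lambda>e. total_degree e = d) u) \<in> J"
    by (intro poly.ideal_sum[OF J(1)]) simp
  moreover have "(\<Sum>d<k. poly_restrict (\<lambda>e. total_degree e = d) u) = u"
    by (rule poly_mapping_eqI) (use k in \<open>force simp: lookup_sum coeff_restrict in_keys_iff\<close>)
  ultimately show "u \<in> J" by simp
qed

section \<open>Elementary symmetric polynomials on a simplex\<close>

definition indicator_exp :: "'v set \<Rightarrow> ('v \<Rightarrow>\<^sub>0 nat)" where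
  "indicator_exp F = (\<Sum>v\<in>F. Poly_Mapping.single v 1)"

lemma lookup_indicator_exp: "finite F \<Longrightarrow> Poly_Mapping.lookup (indicator_exp F) v = (if v \<in> F then 1 else 0)"
  by (simp add: indicator_exp_def lookup_sum lookup_single when_def)

lemma supp_indicator_exp: "finite F \<Longrightarrow> supp (indicator_exp F) = F"
  by (auto simp: in_keys_iff lookup_indicator_exp split: if_splits)

lemma total_degree_indicator_exp: "finite F \<Longrightarrow> total_degree (indicator_exp F) = card F"
  by (simp add: total_degree_def supp_indicator_exp lookup_indicator_exp)

lemma monom_indicator_exp: "finite F \<Longrightarrow> monom (indicator_exp F) (1::'k::field) = (\<Prod>v\<in>F. mvar v)"
proof (induction F rule: finite_induct)
  case (insert v F)
  have "monom (indicator_exp (insert v F)) (1::'k) = mvar v * monom (indicator_exp F) 1"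
    using insert.hyps by (simp add: indicator_exp_def mvar_def mult_single)
  then show ?case using insert by simp
qed (simp add: indicator_exp_def)

definition elem_sym :: "'v set \<Rightarrow> nat \<Rightarrow> ('v, 'k::field) mpol" where
  "elem_sym V i = (\<Sum>F\<in>{F. F \<subseteq> V \<and> card F = i}. monom (indicator_exp F) 1)"

abbreviation elem_syms :: "'v set \<Rightarrow> nat \<Rightarrow> ('v, 'k::field) mpol list" where
  "elem_syms V t \<equiv> map (elem_sym V) [1..<Suc t]"

lemma monomials_elem_sym:
  assumes "finite V"
  shows "monomials (elem_sym V i :: ('v, 'k::field) mpol) \<subseteq> indicator_exp ` {F. F \<subseteq> V \<and> card F = i}"
proof -
  have "monomials (elem_sym V i :: ('v, 'k) mpol)
      \<subseteq> (\<Union>F\<in>{F. F \<subseteq> V \<and> card F = i}. monomials (monom (indicator_exp F) (1::'k)))"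
    unfolding elem_sym_def by (rule monomials_sum)
  then show ?thesis by auto
qed

lemma elem_sym_polys:
  assumes "finite V"
  shows "elem_sym V i \<in> polys V"
  unfolding elem_sym_def
  by (rule poly.sum_S) (use assms in \<open>auto intro!: monom_polys simp: supp_indicator_exp finite_subset\<close>)

lemma homogeneous_elem_sym: "finite V \<Longrightarrow> homogeneous i (elem_sym V i :: ('v, 'k::field) mpol)"
  using monomials_elem_sym[of V i, where 'k = 'k]
  by (force simp: homogeneous_def total_degree_indicator_exp dest: finite_subset)

lemma homogeneous_mvar: "homogeneous 1 (mvar v :: ('v, 'k::field) mpol)"
  by (simp add: homogeneous_def mvar_def total_degree_def)

text \<open>
  A \<open>card B\<close>-subset of \<open>V\<close> other than \<open>B\<close> is not contained in \<open>B\<close>, so on the simplex \<open>B\<close> only the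
  product of all vertices is left of the elementary symmetric polynomial of degree \<open>card B\<close>.
\<close>

lemma elem_sym_simplex:
  assumes "finite V" "B \<subseteq> V"
  shows "elem_sym V (card B) - (\<Prod>v\<in>B. mvar v) \<in> (sr_ideal V (Pow B) :: ('v, 'k::field) mpol set)"
proof -
  have fin: "finite B" "finite {F. F \<subseteq> V \<and> card F = card B}" using assms finite_subset by auto
  define T where "T = {F. F \<subseteq> V \<and> card F = card B} - {B}"
  have "elem_sym V (card B) = monom (indicator_exp B) (1::'k) + (\<Sum>F\<in>T. monom (indicator_exp F) 1)"
    unfolding elem_sym_def T_def using fin assms by (intro sum.remove) auto
  then have "elem_sym V (card B) - (\<Prod>v\<in>B. mvar v) = (\<Sum>F\<in>T. monom (indicator_exp F) (1::'k))"
    by (simp add: monom_indicator_exp[OF fin(1)])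
  moreover have "(\<Sum>F\<in>T. monom (indicator_exp F) (1::'k)) \<in> sr_ideal V (Pow B)"
  proof (rule poly.ideal_sum[OF ideal_sr])
    fix F assume "F \<in> T"
    then show "monom (indicator_exp F) (1::'k) \<in> sr_ideal V (Pow B)"
      using card_subset_eq[OF fin(1), of F] finite_subset[OF _ assms(1), of F]
      by (auto simp: T_def sr_ideal_def monom_polys supp_indicator_exp)
  qed (auto simp: down_closed_def)
  ultimately show ?thesis by simp
qed

lemma down_closed_Pow: "down_closed (Pow B)"
  by (auto simp: down_closed_def)

text \<open>
  Induction on the number of vertices of \<open>B\<close>. For each vertex \<open>y\<close> of \<open>B\<close>, the sequence (without
  \<open>e\<^sub>t\<close> if \<open>t = card B\<close>) is weakly regular on \<open>B - {y}\<close>, that is, modulo \<open>y\<close>; since all ideals involved are homogeneous, \<open>y\<close> may be moved to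
  the end of the sequence and dropped. This settles \<open>t < card B\<close>, and for \<open>t = card B\<close> it settles all but the last
  polynomial \<open>e\<^sub>t\<close>. The latter is the product of all vertices \<open>y\<close>, each of which is regular at the end of the
  sequence \<open>e\<^sub>1, \<dots>, e\<^bsub>t-1\<^esub>\<close>.
\<close>

lemma elem_syms_regular_simplex:
  assumes "finite V" "B \<subseteq> V" "t \<le> card B"
  shows "poly.weakly_regular V (sr_ideal V (Pow B) :: ('v, 'k::field) mpol set) (elem_syms V t)"
  using assms(2,3)
proof (induction "card B" arbitrary: B t)
  case 0
  then show ?case by simp
next
  case (Suc b)
  let ?I = "sr_ideal V (Pow B) :: ('v, 'k) mpol set"
  have I: "poly.is_ideal V ?I" by (rule ideal_sr[OF down_closed_Pow])
  have set: "set (elem_syms V s :: ('v, 'k) mpol list) \<subseteq> polys V" for s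
    using elem_sym_polys[OF assms(1)] by auto
  have fB: "finite B" using Suc.hyps(2) card.infinite by fastforce
  have rotate: "poly.weakly_regular V ?I (elem_syms V s @ [mvar y])" if y: "y \<in> B" and s: "s \<le> b" for y s
  proof (rule poly.weakly_regular_rotate[OF I _ set])
    have yV: "y \<in> V" using y Suc.prems by blast
    then show "mvar y \<in> polys V" by (rule mvar_polys)
    have "poly.colon V ?I (mvar y) = ?I"
      using sr_colon[OF down_closed_Pow yV, of B] y by (simp add: star_def Pow_def)
    then have "poly.regular_mod V ?I (mvar y)"
      unfolding poly.regular_mod_def poly.colon_def by blast
    moreover have "poly.adjoin V ?I (mvar y) = sr_ideal V (Pow (B - {y}))"
      unfolding sr_adjoin[OF down_closed_Pow yV] by (rule arg_cong[of _ _ "sr_ideal V"]) (auto simp: deletion_def)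
    moreover have "poly.weakly_regular V (sr_ideal V (Pow (B - {y})) :: ('v, 'k) mpol set) (elem_syms V s)"
      using Suc.hyps(2) Suc.prems(1) y s fB by (intro Suc.hyps(1)) auto
    ultimately show "poly.weakly_regular V ?I (mvar y # elem_syms V s)" by simp
    fix i
    have "set (take i (elem_syms V s :: ('v, 'k) mpol list)) \<subseteq> set (elem_syms V s)"
      by (rule set_take_subset)
    then have hom: "\<exists>d. homogeneous d f" and sub: "f \<in> polys V"
      if "f \<in> set (take i (elem_syms V s :: ('v, 'k) mpol list))" for f
      using that homogeneous_elem_sym[OF assms(1)] elem_sym_polys[OF assms(1)] by fastforce+
    show "poly.separated V (poly.adjoin_list V ?I (take i (elem_syms V s))) (mvar y)"
      using hom sub
      by (intro graded_separated homogeneous_mvar graded_adjoin_list graded_sr poly.ideal_adjoin_list I) auto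
  qed
  show ?case
  proof (cases "t = Suc b")
    case False
    then have t: "t \<le> b" using Suc.hyps(2) Suc.prems by simp
    obtain y where "y \<in> B" using Suc.hyps(2) by fastforce
    from rotate[OF this t] show ?thesis by (simp add: poly.weakly_regular_append)
  next
    case True
    let ?J = "poly.adjoin_list V ?I (elem_syms V b)"
    have J: "poly.is_ideal V ?J" by (rule poly.ideal_adjoin_list[OF I set])
    have "poly.regular_mod V ?J (mvar y)" if "y \<in> B" for y
      using rotate[OF that] by (simp add: poly.weakly_regular_append)
    moreover have "(mvar y :: ('v, 'k) mpol) \<in> polys V" if "y \<in> B" for y
      by (rule mvar_polys) (use that Suc.prems in blast)
    ultimately have "poly.regular_mod V ?J (\<Prod>y\<in>B. mvar y)"
      using poly.regular_mod_prod[of B mvar V ?J] by simp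
    moreover have "elem_sym V t - (\<Prod>y\<in>B. mvar y) \<in> ?J"
      using elem_sym_simplex[OF assms(1) Suc.prems(1)] poly.subset_adjoin_list True Suc.hyps(2) by (metis subsetD)
    ultimately have "poly.regular_mod V ?J (elem_sym V t)"
      using poly.regular_mod_cong[OF J] by blast
    moreover have "poly.weakly_regular V ?I (elem_syms V b)"
    proof -
      obtain y where "y \<in> B" using Suc.hyps(2) by fastforce
      from rotate[OF this order.refl] show ?thesis by (simp add: poly.weakly_regular_append)
    qed
    ultimately show ?thesis using True by (simp add: poly.weakly_regular_append)
  qed
qed

section \<open>Complexes that split into large simplices\<close>

text \<open>
  Similar to vertex decomposability, but with the star of \<open>v\<close> in place of the link and without a
  shedding condition; instead, the sizes of the simplices at the leaves are bounded below.
\<close>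

inductive splits :: "nat \<Rightarrow> 'v set set \<Rightarrow> bool" for t where
  simplex: "finite B \<Longrightarrow> t \<le> card B \<Longrightarrow> splits t (Pow B)"
| vertex: "{v} \<in> \<Delta> \<Longrightarrow> splits t (deletion v \<Delta>) \<Longrightarrow> splits t (star v \<Delta>) \<Longrightarrow> splits t \<Delta>"

lemma splits_regular:
  assumes "splits t \<Delta>" "down_closed \<Delta>" "finite V" "\<Union>\<Delta> \<subseteq> V"
  shows "poly.weakly_regular V (sr_ideal V \<Delta> :: ('v, 'k::field) mpol set) (elem_syms V t)"
  using assms(1,2,4)
proof (induction rule: splits.induct)
  case (simplex B)
  then show ?case by (intro elem_syms_regular_simplex[OF assms(3)]) auto
next
  case (vertex v \<Delta>)
  have v: "v \<in> V" using vertex by blast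
  show ?case
  proof (rule poly.weakly_regular_exact[OF ideal_sr[OF vertex.prems(1)]])
    show "mvar v \<in> polys V" by (rule mvar_polys[OF v])
    show "set (elem_syms V t) \<subseteq> polys V" using elem_sym_polys[OF assms(3)] by auto
    have sub: "\<Union>(star v \<Delta>) \<subseteq> V" "\<Union>(deletion v \<Delta>) \<subseteq> V"
      using vertex.prems by (auto simp: star_def deletion_def)
    let ?I = "sr_ideal V \<Delta> :: ('v, 'k) mpol set"
    show "poly.weakly_regular V (poly.colon V ?I (mvar v)) (elem_syms V t)"
      "poly.weakly_regular V (poly.adjoin V ?I (mvar v)) (elem_syms V t)"
      unfolding sr_colon[OF vertex.prems(1) v] sr_adjoin[OF vertex.prems(1) v]
      using vertex.IH(2)[OF down_closed_star[OF vertex.prems(1)] sub(1)]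
        vertex.IH(1)[OF down_closed_deletion[OF vertex.prems(1)] sub(2)] by - assumption+
  qed
qed

section \<open>Facets bound the length of weakly regular sequences\<close>

definition facet :: "'v set set \<Rightarrow> 'v set \<Rightarrow> bool" where
  "facet \<Delta> A \<longleftrightarrow> A \<in> \<Delta> \<and> (\<forall>F\<in>\<Delta>. A \<subseteq> F \<longrightarrow> F = A)"

lemma facet_insert: "facet \<Delta> A \<Longrightarrow> v \<notin> A \<Longrightarrow> insert v A \<notin> \<Delta>"
  unfolding facet_def by blast

text \<open>
  More vectors than coordinates are linearly dependent; \<open>h a e\<close> is the coordinate \<open>e\<close> of the vector
  \<open>a\<close>. Gaussian elimination of one coordinate at a time.
\<close>

lemma linear_relation:
  fixes h :: "'a \<Rightarrow> 'b \<Rightarrow> 'k::field"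
  assumes "finite E" "finite F" "card E < card F"
  obtains c where "\<exists>a\<in>F. c a \<noteq> 0" "\<And>e. e \<in> E \<Longrightarrow> (\<Sum>a\<in>F. c a * h a e) = 0"
proof -
  have "\<exists>c. (\<exists>a\<in>F. c a \<noteq> 0) \<and> (\<forall>e\<in>E. (\<Sum>a\<in>F. c a * h a e) = 0)"
    using assms
  proof (induction E arbitrary: F h rule: finite_induct)
    case empty
    then have "F \<noteq> {}" by auto
    then show ?case by (intro exI[of _ "\<lambda>_. 1"]) auto
  next
    case (insert e E)
    show ?case
    proof (cases "\<forall>a\<in>F. h a e = 0")
      case True
      then show ?thesis using insert.IH[of F h] insert.prems insert.hyps by auto
    next
      case False
      then obtain b where b: "b \<in> F" "h b e \<noteq> 0" by blast
      have "card E < card (F - {b})" using insert b by simp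
      then obtain c where c: "\<exists>a\<in>F - {b}. c a \<noteq> 0"
        "\<forall>e'\<in>E. (\<Sum>a\<in>F - {b}. c a * (h a e' - h a e / h b e * h b e')) = 0"
        using insert.IH[of "F - {b}" "\<lambda>a e'. h a e' - h a e / h b e * h b e'"] insert.prems(1) by auto
      define d where "d a = (if a = b then - (\<Sum>a\<in>F - {b}. c a * h a e / h b e) else c a)" for a
      have sum_d: "(\<Sum>a\<in>F. d a * h a e') = (\<Sum>a\<in>F - {b}. c a * (h a e' - h a e / h b e * h b e'))" for e'
      proof -
        have "(\<Sum>a\<in>F. d a * h a e') = d b * h b e' + (\<Sum>a\<in>F - {b}. d a * h a e')"
          using insert.prems(1) b(1) by (rule sum.remove)
        also have "(\<Sum>a\<in>F - {b}. d a * h a e') = (\<Sum>a\<in>F - {b}. c a * h a e')"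
          by (rule sum.cong) (auto simp: d_def)
        also have "d b * h b e' = - (\<Sum>a\<in>F - {b}. c a * h a e / h b e * h b e')"
          by (simp add: d_def sum_distrib_right)
        finally show ?thesis by (simp add: algebra_simps sum_subtractf)
      qed
      have "\<exists>a\<in>F. d a \<noteq> 0" using c(1) by (auto simp: d_def)
      moreover have "(\<Sum>a\<in>F. d a * h a e) = 0" unfolding sum_d using b by simp
      ultimately show ?thesis using c(2) sum_d by auto
    qed
  qed
  then show ?thesis using that by blast
qed

lemma card_bounded_exponents:
  assumes "finite A"
  shows "finite {e. supp e \<subseteq> A \<and> (\<forall>v. Poly_Mapping.lookup e v \<le> N)}" (is "finite ?E")
    and "card {e. supp e \<subseteq> A \<and> (\<forall>v. Poly_Mapping.lookup e v \<le> N)} \<le> (N + 1) ^ card A"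
proof -
  let ?\<phi> = "\<lambda>e. restrict (Poly_Mapping.lookup e) A"
  have inj: "inj_on ?\<phi> ?E"
  proof (rule inj_onI, rule poly_mapping_eqI)
    fix a b v assume ab: "a \<in> ?E" "b \<in> ?E" "?\<phi> a = ?\<phi> b"
    show "Poly_Mapping.lookup a v = Poly_Mapping.lookup b v"
    proof (cases "v \<in> A")
      case True
      then show ?thesis using fun_cong[OF ab(3), of v] by simp
    next
      case False
      then have "v \<notin> supp a" "v \<notin> supp b" using ab by auto
      then show ?thesis by (simp add: in_keys_iff)
    qed
  qed
  have sub: "?\<phi> ` ?E \<subseteq> A \<rightarrow>\<^sub>E {..N}" by auto
  have fin: "finite (A \<rightarrow>\<^sub>E {..N})" by (rule finite_PiE) (use assms in auto)
  show "finite ?E" using inj sub fin by (rule inj_on_finite)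
  have "card ?E \<le> card (A \<rightarrow>\<^sub>E {..N})" using inj sub fin by (rule card_inj_on_le)
  then show "card ?E \<le> (N + 1) ^ card A" using assms by (simp add: card_PiE)
qed

definition exponent_bound :: "nat \<Rightarrow> ('v, 'k::zero) mpol \<Rightarrow> bool" where
  "exponent_bound N p \<longleftrightarrow> (\<forall>e\<in>monomials p. \<forall>v. Poly_Mapping.lookup e v \<le> N)"

lemma exponent_bound_mult:
  fixes p q :: "('v, 'k::field) mpol"
  shows "exponent_bound M p \<Longrightarrow> exponent_bound N q \<Longrightarrow> exponent_bound (M + N) (p * q)"
  by (fastforce simp: exponent_bound_def lookup_add intro: add_mono dest!: monomials_mult_subset)

lemma exponent_bound_power:
  fixes p :: "('v, 'k::field) mpol"
  shows "exponent_bound M p \<Longrightarrow> exponent_bound (k * M) (p ^ k)"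
  by (induction k) (auto simp: exponent_bound_mult, simp add: exponent_bound_def)

lemma exponent_bound_list_monomial:
  fixes gs :: "('v, 'k::field) mpol list"
  assumes "\<And>g. g \<in> set gs \<Longrightarrow> exponent_bound M g" "\<And>a. a \<in> set as \<Longrightarrow> a \<le> d"
  shows "exponent_bound (length gs * (d * M)) (poly.list_monomial gs as)"
  using assms
proof (induction gs arbitrary: as)
  case Nil
  then show ?case by (simp add: poly.list_monomial_def exponent_bound_def)
next
  case (Cons g gs)
  show ?case
  proof (cases as)
    case Nil
    then show ?thesis by (simp add: poly.list_monomial_def exponent_bound_def)
  next
    case (Cons a as')
    have "exponent_bound (length gs * (d * M)) (poly.list_monomial gs as')"
      using Cons.IH[of as'] Cons.prems Cons by auto
    moreover have "exponent_bound (a * M) (g ^ a)"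
      using exponent_bound_power Cons.prems(1)[of g] by auto
    ultimately have "exponent_bound (a * M + length gs * (d * M)) (poly.list_monomial (g # gs) as)"
      unfolding Cons poly.list_monomial_Cons by (rule exponent_bound_mult[rotated])
    moreover have "a * M \<le> d * M" using Cons.prems(2)[of a] Cons by simp
    ultimately show ?thesis unfolding exponent_bound_def
      by (fastforce intro: order.trans[OF _ add_mono])
  qed
qed

lemma exponent_bound_exists:
  fixes gs :: "('v, 'k::field) mpol list"
  obtains M where "\<And>g. g \<in> set gs \<Longrightarrow> exponent_bound M g"
proof -
  have "finite (\<Union>g\<in>set gs. total_degree ` monomials g)" by simp
  then obtain M where "\<And>n. n \<in> (\<Union>g\<in>set gs. total_degree ` monomials g) \<Longrightarrow> n \<le> M"
    by (meson Max_ge)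
  then have "exponent_bound M g" if "g \<in> set gs" for g
    using that order.trans[OF lookup_le_total_degree] unfolding exponent_bound_def by (metis UN_I imageI)
  then show ?thesis using that by blast
qed

lemma degree_power_ge:
  fixes f :: "('v, 'k::field) mpol"
  assumes "0 \<notin> monomials f" "e \<in> monomials (f ^ k)"
  shows "k \<le> total_degree e"
  using assms(2)
proof (induction k arbitrary: e)
  case (Suc k)
  then obtain a b where ab: "a \<in> monomials f" "b \<in> monomials (f ^ k)" "e = a + b"
    using monomials_mult_subset[of e f "f ^ k"] by auto
  then obtain v where "Poly_Mapping.lookup a v \<noteq> 0"
    using assms(1) by (metis lookup_zero poly_mapping_eqI)
  then have "total_degree a \<ge> 1" using lookup_le_total_degree[of a v] by linarith
  then show ?case using Suc.IH[OF ab(2)] ab(3) by (simp add: total_degree_add)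
qed simp

text \<open>
  Suppose \<open>r = length fs\<close> exceeds \<open>card A\<close>. The monomials with exponents below \<open>d\<close> in the powers \<open>f\<^sub>i\<^sup>k\<close> number \<open>d\<^sup>r\<close>,
  while their images in \<open>K[A]\<close> lie in a space whose dimension grows only like \<open>d\<^sup>c\<close> for \<open>c = card A\<close>. So for large
  \<open>d\<close> some nontrivial combination \<open>q\<close> of them has no term in the variables of \<open>A\<close> alone. Then \<open>x\<^sub>A q\<close> lies
  in the Stanley--Reisner ideal, against \<open>weakly_regular_independent\<close>.
\<close>

lemma facet_bounds_regular:
  fixes fs :: "('v, 'k::field) mpol list"
  assumes V: "finite V" and \<Delta>: "down_closed \<Delta>"
    and AV: "A \<subseteq> V" and facet: "facet \<Delta> A"
    and fs: "set fs \<subseteq> polys V" "\<And>f. f \<in> set fs \<Longrightarrow> 0 \<notin> monomials f"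
    and reg: "poly.weakly_regular V (sr_ideal V \<Delta>) fs"
  shows "length fs \<le> card A"
proof (rule ccontr)
  assume "\<not> length fs \<le> card A"
  then have len: "card A < length fs" by simp
  let ?I = "sr_ideal V \<Delta> :: ('v, 'k) mpol set"
  have I: "poly.is_ideal V ?I" by (rule ideal_sr[OF \<Delta>])
  have A: "A \<subseteq> V" "A \<in> \<Delta>" "\<And>v. v \<in> V - A \<Longrightarrow> insert v A \<notin> \<Delta>"
    using AV facet facet_insert by (auto simp: facet_def)
  have finA: "finite A" using A V finite_subset by blast
  \<comment> \<open>Monomials of degree at least \<open>k\<close> cannot interfere with \<open>x\<^sub>A\<close>, which has degree \<open>card A\<close>.\<close>
  define k where "k = Suc (card A)"
  define gs where "gs = map (\<lambda>f. f ^ k) fs"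
  have gs: "set gs \<subseteq> polys V" using fs(1) poly.power_S by (auto simp: gs_def)
  have reg': "poly.weakly_regular V ?I gs"
    unfolding gs_def by (rule poly.weakly_regular_powers[OF I fs(1) reg])
  define x where "x = monom (indicator_exp A) (1::'k)"
  have x: "x \<in> polys V" unfolding x_def using A(1) finA by (simp add: monom_polys supp_indicator_exp)
  \<comment> \<open>An ideal containing \<open>I\<close> and all \<open>f\<^sub>i\<^sup>k\<close>, but not \<open>x\<^sub>A\<close>.\<close>
  define L :: "('v, 'k) mpol set" where "L = {p \<in> polys V. \<forall>e\<in>monomials p. k \<le> total_degree e \<or> supp e \<notin> \<Delta>} "
  have "poly.is_ideal V L"
    unfolding poly.is_ideal_def
  proof (intro conjI ballI)
    show "L \<subseteq> polys V" "0 \<in> L" by (auto simp: L_def poly.zero_S)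
    fix a b :: "('v, 'k) mpol" assume a: "a \<in> L"
    { assume "b \<in> L" then show "a + b \<in> L"
        using a Poly_Mapping.keys_add[of a b] by (auto simp: L_def poly.add_S) }
    assume b: "b \<in> polys V"
    have "k \<le> total_degree e \<or> supp e \<notin> \<Delta>" if e: "e \<in> monomials (b * a)" for e
    proof -
      obtain i j where "i \<in> monomials b" "j \<in> monomials a" "e = i + j"
        using monomials_mult_subset[OF e] by blast
      then show ?thesis using a down_closedD[OF \<Delta>, of "supp e" "supp j"]
        by (force simp: L_def supp_add total_degree_add)
    qed
    then show "b * a \<in> L" using a b by (auto simp: L_def poly.mult_S)
  qed
  moreover have "?I \<subseteq> L" by (auto simp: sr_ideal_def L_def)
  moreover have "set gs \<subseteq> L"
    using gs fs(2) degree_power_ge by (fastforce simp: L_def gs_def)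
  ultimately have "poly.adjoin_list V ?I gs \<subseteq> L" by (rule poly.adjoin_list_least)
  moreover have "x \<notin> L"
    using finA A(2) by (simp add: L_def x_def supp_indicator_exp total_degree_indicator_exp k_def)
  ultimately have xn: "x \<notin> poly.adjoin_list V ?I gs" by blast
  obtain M where M: "\<And>g. g \<in> set gs \<Longrightarrow> exponent_bound M g" using exponent_bound_exists by blast
  define r where "r = length gs"
  have r: "card A < r" using len by (simp add: r_def gs_def)
  \<comment> \<open>Large enough that \<open>d\<^bsup>card A + 1\<^esup>\<close> exceeds the number \<open>(r d M + 1)\<^bsup>card A\<^esup>\<close> of available exponents.\<close>
  define d where "d = (r * M + 1) ^ card A + 1"
  define N where "N = r * (d * M)"
  define E where "E = {e. supp e \<subseteq> A \<and> (\<forall>v. Poly_Mapping.lookup e v \<le> N)}"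
  define F where "F = {as. set as \<subseteq> {..<d} \<and> length as = r}"
  have "card E \<le> (N + 1) ^ card A" unfolding E_def by (rule card_bounded_exponents[OF finA])
  also have "\<dots> \<le> (d * (r * M + 1)) ^ card A"
    by (rule power_mono) (simp_all add: N_def d_def algebra_simps)
  also have "\<dots> = d ^ card A * (r * M + 1) ^ card A" by (rule power_mult_distrib)
  also have "\<dots> < d ^ card A * d" by (simp add: d_def)
  also have "\<dots> = d ^ Suc (card A)" by simp
  also have "\<dots> \<le> d ^ r" using r by (intro power_increasing) (auto simp: d_def)
  also have "d ^ r = card F" unfolding F_def by (simp add: card_lists_length_eq)
  finally have card: "card E < card F" .
  have finE: "finite E" unfolding E_def by (rule card_bounded_exponents[OF finA])
  have finF: "finite F" unfolding F_def by (simp add: finite_lists_length_eq)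
  obtain c where c: "\<exists>as\<in>F. c as \<noteq> 0"
    "\<And>e. e \<in> E \<Longrightarrow> (\<Sum>as\<in>F. c as * coeff (poly.list_monomial gs as) e) = 0"
    using linear_relation[OF finE finF card, of "\<lambda>as e. coeff (poly.list_monomial gs as) e"] by blast
  define F' where "F' = {as \<in> F. c as \<noteq> 0}"
  define q where "q = (\<Sum>as\<in>F'. monom 0 (c as) * poly.list_monomial gs as)"
  have const: "monom 0 (b::'k) \<in> polys V" for b by (rule monom_polys) simp
  have q: "q \<in> polys V"
    unfolding q_def by (intro poly.sum_S poly.mult_S const poly.list_monomial_S gs)
  have supp_q: "\<not> supp e \<subseteq> A" if e: "e \<in> monomials q" for e
  proof
    assume sub: "supp e \<subseteq> A"
    have "exponent_bound N (monom 0 (c as) * poly.list_monomial gs as)" if "as \<in> F" for as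
    proof -
      have "exponent_bound 0 (monom 0 (c as) :: ('v, 'k) mpol)" by (simp add: exponent_bound_def)
      moreover have "exponent_bound N (poly.list_monomial gs as)"
        unfolding N_def r_def by (rule exponent_bound_list_monomial[OF M]) (use that in \<open>auto simp: F_def\<close>)
      ultimately show ?thesis using exponent_bound_mult by fastforce
    qed
    then have "Poly_Mapping.lookup e v \<le> N" for v
      using e monomials_sum[of "\<lambda>as. monom 0 (c as) * poly.list_monomial gs as" F']
      unfolding q_def exponent_bound_def F'_def by blast
    then have "e \<in> E" using sub by (simp add: E_def)
    moreover have "coeff q e = (\<Sum>as\<in>F'. c as * coeff (poly.list_monomial gs as) e)"
      by (simp add: q_def lookup_sum coeff_monom_times[of 0, simplified])
    moreover have "\<dots> = (\<Sum>as\<in>F. c as * coeff (poly.list_monomial gs as) e)"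
      using finF by (intro sum.mono_neutral_left) (auto simp: F'_def)
    ultimately have "coeff q e = 0" using c(2) by simp
    then show False using e by (simp add: in_keys_iff)
  qed
  have "x * q \<in> ?I"
  proof -
    have "supp e \<notin> \<Delta>" if e: "e \<in> monomials (x * q)" for e
    proof -
      obtain b where b: "b \<in> monomials q" "e = indicator_exp A + b"
        using e by (auto simp: x_def monomials_monom_times)
      then obtain v where v: "v \<in> supp b" "v \<notin> A" using supp_q by blast
      then have "v \<in> V - A" using q b by (auto simp: polys_def)
      then have "insert v A \<notin> \<Delta>" by (rule A(3))
      moreover have "insert v A \<subseteq> supp e" using b v finA by (auto simp: supp_add supp_indicator_exp)
      ultimately show ?thesis using down_closedD[OF \<Delta>] by blast
    qed
    then show ?thesis using x q by (simp add: sr_ideal_def poly.mult_S)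
  qed
  then have "(\<Sum>as\<in>F'. monom 0 (c as) * poly.list_monomial gs as * x) \<in> ?I"
    by (simp add: q_def sum_distrib_left mult.commute)
  then have "F' = {}"
  proof (rule poly.weakly_regular_independent[OF I gs reg' x xn, rotated 3])
    show "finite F'" using finF by (simp add: F'_def)
    show "length as = length gs" if "as \<in> F'" for as using that by (simp add: F'_def F_def r_def)
    fix as assume "as \<in> F'"
    then have "monom 0 (inverse (c as)) * monom 0 (c as) = (1 :: ('v, 'k) mpol)"
      by (simp add: F'_def mult_single)
    then show "monom 0 (c as) \<in> polys V \<and> (\<exists>d\<in>polys V. d * monom 0 (c as) = 1)"
      using const by blast
  qed
  then show False using c(1) by (auto simp: F'_def)
qed

section \<open>The quotient ring as a module\<close>

lemma mpoly_ring_simps [simp]: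
  "carrier (mpoly_ring V) = polys V" "monoid.mult (mpoly_ring V) = (*)" "one (mpoly_ring V) = 1"
  "zero (mpoly_ring V) = 0" "add (mpoly_ring V) = (+)"
  by (simp_all add: mpoly_ring_def polys_def)

lemma cring_mpoly_ring: "cring (mpoly_ring V :: ('v, 'k::field) mpol ring)"
proof (rule cringI)
  show "abelian_group (mpoly_ring V :: ('v, 'k) mpol ring)"
    by (rule abelian_groupI) (auto intro: poly.S_intros bexI[of _ "- _"] simp: add_ac)
  show "comm_monoid (mpoly_ring V :: ('v, 'k) mpol ring)"
    by (rule comm_monoidI) (auto intro: poly.S_intros simp: mult_ac)
qed (auto simp: algebra_simps)

lemma ideal_mpoly_ring:
  fixes J :: "('v, 'k::field) mpol set"
  assumes "poly.is_ideal V J"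
  shows "ideal J (mpoly_ring V)"
proof (rule idealI)
  interpret cring "mpoly_ring V :: ('v, 'k) mpol ring" by (rule cring_mpoly_ring)
  show "ring (mpoly_ring V :: ('v, 'k) mpol ring)" by (rule ring_axioms)
  have inv: "\<ominus>\<^bsub>mpoly_ring V\<^esub> a = - a" if "a \<in> polys V" for a :: "('v, 'k) mpol"
    using that by (intro minus_equality) (auto intro: poly.S_intros)
  show "subgroup J (add_monoid (mpoly_ring V))"
  proof (rule add.subgroupI)
    show "\<ominus>\<^bsub>mpoly_ring V\<^esub> a \<in> J" if "a \<in> J" for a
      using that assms inv poly.ideal_uminus poly.ideal_subset by metis
  qed (use assms poly.ideal_zero poly.ideal_add poly.ideal_subset in auto)
  fix a x :: "('v, 'k) mpol" assume "a \<in> J" "x \<in> carrier (mpoly_ring V)"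
  then show "x \<otimes>\<^bsub>mpoly_ring V\<^esub> a \<in> J" "a \<otimes>\<^bsub>mpoly_ring V\<^esub> x \<in> J"
    using poly.ideal_mult[OF assms] poly.ideal_mult_right[OF assms] by auto
qed

abbreviation coset :: "'v set \<Rightarrow> ('v, 'k::field) mpol set \<Rightarrow> ('v, 'k) mpol \<Rightarrow> ('v, 'k) mpol set" where
  "coset V J p \<equiv> J +>\<^bsub>mpoly_ring V\<^esub> p"

abbreviation quot :: "'v set \<Rightarrow> ('v, 'k::field) mpol set \<Rightarrow> (('v, 'k) mpol, ('v, 'k) mpol set) module" where
  "quot V J \<equiv> quot_module (mpoly_ring V) J"

lemma coset_eq: "coset V J p = {j + p | j. j \<in> J}"
  by (auto simp: a_r_coset_def' )

lemma coset_eq_iff: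
  assumes "poly.is_ideal V J"
  shows "coset V J p = coset V J q \<longleftrightarrow> p - q \<in> J"
proof
  assume "coset V J p = coset V J q"
  moreover have "p \<in> coset V J p" using poly.ideal_zero[OF assms] by (force simp: coset_eq)
  ultimately show "p - q \<in> J" by (auto simp: coset_eq)
next
  assume pq: "p - q \<in> J"
  have "coset V J p \<subseteq> coset V J q" if "p - q \<in> J" for p q
  proof
    fix x assume "x \<in> coset V J p"
    then obtain j where "j \<in> J" "x = j + p" by (auto simp: coset_eq)
    then have "x = (j + (p - q)) + q" "j + (p - q) \<in> J"
      using poly.ideal_add[OF assms _ that] by auto
    then show "x \<in> coset V J q" unfolding coset_eq by blast
  qed
  from this[OF pq] this[of q p] show "coset V J p = coset V J q"
    using poly.ideal_uminus[OF assms pq] by simp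
qed

context
  fixes V :: "'v set" and J :: "('v, 'k::field) mpol set"
  assumes J: "poly.is_ideal V J"
begin

interpretation J: ideal J "mpoly_ring V" by (rule ideal_mpoly_ring[OF J])

lemma carrier_quot: "carrier (quot V J) = coset V J ` polys V"
  by (auto simp: quot_module_def FactRing_def A_RCOSETS_def')

lemma zero_quot: "zero (quot V J) = coset V J 0"
proof -
  have "zero (quot V J) = J" by (simp add: quot_module_def FactRing_def)
  then show ?thesis by (simp add: coset_eq)
qed

lemma add_quot:
  assumes "p \<in> polys V" "q \<in> polys V"
  shows "coset V J p \<oplus>\<^bsub>quot V J\<^esub> coset V J q = coset V J (p + q)"
  using J.a_rcos_sum[of p q] assms by (simp add: quot_module_def FactRing_def)

lemma smult_quot:
  assumes "p \<in> polys V" "q \<in> polys V"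
  shows "p \<odot>\<^bsub>quot V J\<^esub> coset V J q = coset V J (p * q)"
  using J.rcoset_mult_add[of p q] assms by (simp add: quot_module_def FactRing_def)

lemma abelian_monoid_quot: "abelian_monoid (quot V J)"
  by (rule abelian_monoidI) (auto simp: carrier_quot zero_quot add_quot add_ac poly.add_S poly.zero_S)

lemma finsum_quot:
  assumes "finite A" "\<And>i. i \<in> A \<Longrightarrow> g i \<in> polys V" "\<And>i. i \<in> A \<Longrightarrow> y i = coset V J (g i)"
  shows "finsum (quot V J) y A = coset V J (sum g A)"
proof -
  interpret M: abelian_monoid "quot V J" by (rule abelian_monoid_quot)
  show ?thesis
    using assms
  proof (induction A rule: finite_induct)
    case (insert i A)
    then have "y \<in> A \<rightarrow> carrier (quot V J)" "y i \<in> carrier (quot V J)"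
      by (auto simp: carrier_quot)
    then show ?case
      using insert by (simp add: M.finsum_insert add_quot poly.sum_S)
  qed (simp add: zero_quot)
qed

end

section \<open>Depth\<close>

lemma (in ambient_subring) adjoin_list_iff:
  "x \<in> adjoin_list J fs \<longleftrightarrow>
    (\<exists>s. (\<forall>i<length fs. s i \<in> S) \<and> x - (\<Sum>i<length fs. fs ! i * s i) \<in> J)"
proof (induction fs arbitrary: x rule: rev_induct)
  case (snoc g fs)
  let ?n = "length fs"
  show ?case
  proof
    assume "x \<in> adjoin_list J (fs @ [g])"
    then obtain t where t: "t \<in> S" "x - g * t \<in> adjoin_list J fs"
      by (auto simp: adjoin_list_snoc adjoin_iff)
    then obtain s where s: "\<forall>i<?n. s i \<in> S" "x - g * t - (\<Sum>i<?n. fs ! i * s i) \<in> J"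
      using snoc by auto
    have "(\<Sum>i<?n. (fs @ [g]) ! i * (s(?n := t)) i) = (\<Sum>i<?n. fs ! i * s i)"
      by (rule sum.cong) (auto simp: nth_append)
    then show "\<exists>s. (\<forall>i<length (fs @ [g]). s i \<in> S) \<and> x - (\<Sum>i<length (fs @ [g]). (fs @ [g]) ! i * s i) \<in> J"
      using s t(1) by (intro exI[of _ "s(?n := t)"]) (auto simp: less_Suc_eq algebra_simps)
  next
    assume "\<exists>s. (\<forall>i<length (fs @ [g]). s i \<in> S) \<and> x - (\<Sum>i<length (fs @ [g]). (fs @ [g]) ! i * s i) \<in> J"
    then obtain s where s: "\<forall>i<Suc ?n. s i \<in> S" "x - ((\<Sum>i<?n. (fs @ [g]) ! i * s i) + g * s ?n) \<in> J"
      by auto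
    have "(\<Sum>i<?n. (fs @ [g]) ! i * s i) = (\<Sum>i<?n. fs ! i * s i)"
      by (rule sum.cong) (auto simp: nth_append)
    then have "x - g * s ?n \<in> adjoin_list J fs"
      unfolding snoc using s by (intro exI[of _ s]) (auto simp: algebra_simps)
    then show "x \<in> adjoin_list J (fs @ [g])"
      using s(1) by (auto simp: adjoin_list_snoc adjoin_iff)
  qed
qed simp

text \<open>
  Translates \<open>(f\<^sub>1, \<dots>, f\<^sub>r) (S/J)\<close> into the ideal \<open>J + (f\<^sub>1, \<dots>, f\<^sub>r)\<close>, so that regular sequences on the quotient module
  can be studied by ideals of \<open>S\<close> alone.
\<close>

lemma seq_mult_quot:
  fixes J :: "('v, 'k::field) mpol set"
  assumes J: "poly.is_ideal V J" and fs: "set fs \<subseteq> polys V" and x: "x \<in> polys V"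
  shows "coset V J x \<in> seq_mult (quot V J) fs \<longleftrightarrow> x \<in> poly.adjoin_list V J fs"
proof -
  let ?n = "length fs"
  have fin: "finsum (quot V J) (\<lambda>i. fs ! i \<odot>\<^bsub>quot V J\<^esub> y i) {..<?n} = coset V J (\<Sum>i<?n. fs ! i * s i)"
    if "\<forall>i<?n. s i \<in> polys V" "\<forall>i<?n. y i = coset V J (s i)" for y s
    using that fs by (intro finsum_quot[OF J]) (auto simp: smult_quot[OF J] subset_iff intro!: poly.mult_S)
  show ?thesis
  proof
    assume "coset V J x \<in> seq_mult (quot V J) fs"
    then obtain y where y: "y \<in> {..<?n} \<rightarrow> carrier (quot V J)"
      "coset V J x = finsum (quot V J) (\<lambda>i. fs ! i \<odot>\<^bsub>quot V J\<^esub> y i) {..<?n}"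
      unfolding seq_mult_def by blast
    have "\<forall>i<?n. \<exists>s. s \<in> polys V \<and> y i = coset V J s"
      using y(1) by (auto simp: carrier_quot[OF J] Pi_iff)
    then obtain s where s: "\<forall>i<?n. s i \<in> polys V" "\<forall>i<?n. y i = coset V J (s i)" by metis
    then show "x \<in> poly.adjoin_list V J fs"
      using y(2) fin[OF s] by (auto simp: coset_eq_iff[OF J] poly.adjoin_list_iff)
  next
    assume "x \<in> poly.adjoin_list V J fs"
    then obtain s where s: "\<forall>i<?n. s i \<in> polys V" "x - (\<Sum>i<?n. fs ! i * s i) \<in> J"
      unfolding poly.adjoin_list_iff by blast
    then have "coset V J x = finsum (quot V J) (\<lambda>i. fs ! i \<odot>\<^bsub>quot V J\<^esub> coset V J (s i)) {..<?n}"
      using fin[OF s(1), of "\<lambda>i. coset V J (s i)"] by (simp add: coset_eq_iff[OF J])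
    moreover have "(\<lambda>i. coset V J (s i)) \<in> {..<?n} \<rightarrow> carrier (quot V J)"
      using s(1) by (auto simp: carrier_quot[OF J])
    ultimately show "coset V J x \<in> seq_mult (quot V J) fs"
      unfolding seq_mult_def by (intro CollectI exI[of _ "\<lambda>i. coset V J (s i)"] conjI)
  qed
qed

lemma regular_sequence_quot:
  fixes J :: "('v, 'k::field) mpol set"
  assumes J: "poly.is_ideal V J"
  shows "regular_sequence (mpoly_ring V) (quot V J) fs \<longleftrightarrow>
    set fs \<subseteq> polys V \<and> poly.weakly_regular V J fs \<and> seq_mult (quot V J) fs \<noteq> carrier (quot V J)"
proof (cases "set fs \<subseteq> polys V")
  case True
  have "(\<forall>x\<in>carrier (quot V J). fs ! i \<odot>\<^bsub>quot V J\<^esub> x \<in> seq_mult (quot V J) (take i fs)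
            \<longrightarrow> x \<in> seq_mult (quot V J) (take i fs)) \<longleftrightarrow>
        poly.regular_mod V (poly.adjoin_list V J (take i fs)) (fs ! i)" if "i < length fs" for i
  proof -
    have f: "fs ! i \<in> polys V" "set (take i fs) \<subseteq> polys V"
      using True that set_take_subset[of i fs] by auto
    show ?thesis
      using f seq_mult_quot[OF J f(2)]
      by (auto simp: carrier_quot[OF J] poly.regular_mod_def smult_quot[OF J] poly.mult_S)
  qed
  then show ?thesis
    unfolding regular_sequence_def poly.weakly_regular_iff_nth by auto
qed (simp add: regular_sequence_def)

text \<open>
  Covers the edge ideal and the graded maximal ideal, the latter as Stanley--Reisner ideal of the complex \<open>{{}}\<close>.
\<close>

lemma genideal_monomials:
  fixes X :: "('v \<Rightarrow>\<^sub>0 nat) set"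
  assumes X: "\<And>a. a \<in> X \<Longrightarrow> supp a \<subseteq> V" and \<Delta>: "down_closed \<Delta>"
    and iff: "\<And>e. supp e \<subseteq> V \<Longrightarrow> supp e \<notin> \<Delta> \<longleftrightarrow> (\<exists>a\<in>X. \<exists>b. e = a + b)"
  shows "Idl\<^bsub>mpoly_ring V\<^esub> ((\<lambda>a. monom a 1) ` X) = (sr_ideal V \<Delta> :: ('v, 'k::field) mpol set)"
proof -
  interpret R: cring "mpoly_ring V :: ('v, 'k) mpol ring" by (rule cring_mpoly_ring)
  let ?G = "(\<lambda>a. monom a (1::'k)) ` X"
  have G: "?G \<subseteq> carrier (mpoly_ring V)" using X by (auto intro!: monom_polys)
  interpret I: ideal "Idl\<^bsub>mpoly_ring V\<^esub> ?G" "mpoly_ring V" by (rule R.genideal_ideal[OF G])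
  show ?thesis
  proof
    have "supp a \<notin> \<Delta>" if "a \<in> X" for a
      using iff[OF X[OF that]] that by (metis add.right_neutral)
    then show "Idl\<^bsub>mpoly_ring V\<^esub> ?G \<subseteq> sr_ideal V \<Delta>"
      using X by (intro R.genideal_minimal ideal_mpoly_ring ideal_sr[OF \<Delta>]) (auto simp: sr_ideal_def monom_polys)
    show "sr_ideal V \<Delta> \<subseteq> Idl\<^bsub>mpoly_ring V\<^esub> ?G"
    proof
      fix p :: "('v, 'k) mpol" assume p: "p \<in> sr_ideal V \<Delta>"
      have "(\<Sum>e\<in>E. monom e (coeff p e)) \<in> Idl\<^bsub>mpoly_ring V\<^esub> ?G" if "E \<subseteq> monomials p" for E
        using finite_subset[OF that finite_keys] that
      proof (induction E rule: finite_induct)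
        case empty
        show ?case using I.zero_closed by simp
      next
        case (insert e E)
        then have e: "supp e \<subseteq> V" "supp e \<notin> \<Delta>" using p by (auto simp: sr_ideal_def polys_def)
        then obtain a b where ab: "a \<in> X" "e = a + b" using iff by blast
        have "monom b (coeff p e) \<in> carrier (mpoly_ring V)" using e ab by (simp add: monom_polys supp_add)
        moreover have "monom a 1 \<in> Idl\<^bsub>mpoly_ring V\<^esub> ?G" using R.genideal_self[OF G] ab by blast
        ultimately have "monom a 1 * monom b (coeff p e) \<in> Idl\<^bsub>mpoly_ring V\<^esub> ?G"
          using I.I_r_closed by fastforce
        then show ?case using insert I.a_closed ab(2) by (fastforce simp: mult_single)
      qed
      from this[OF order.refl] show "p \<in> Idl\<^bsub>mpoly_ring V\<^esub> ?G" by (simp add: sum_monom)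
    qed
  qed
qed

lemma max_graded_ideal_eq: "max_graded_ideal V = (sr_ideal V {{}} :: ('v, 'k::field) mpol set)"
proof -
  have "(mvar ` V :: ('v, 'k) mpol set) = (\<lambda>a. monom a 1) ` (\<lambda>v. Poly_Mapping.single v 1) ` V"
    by (auto simp: mvar_def)
  moreover have "supp e \<notin> {{}} \<longleftrightarrow> (\<exists>a\<in>(\<lambda>v. Poly_Mapping.single v 1) ` V. \<exists>b. e = a + b)"
    if "supp e \<subseteq> V" for e
  proof
    assume "supp e \<notin> {{}}"
    then obtain v where v: "v \<in> supp e" by (metis all_not_in_conv singletonI)
    then have "e = Poly_Mapping.single v 1 + (e - Poly_Mapping.single v 1)"
      by (intro poly_mapping_eqI) (auto simp: lookup_add lookup_minus lookup_single when_def in_keys_iff)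
    then show "\<exists>a\<in>(\<lambda>v. Poly_Mapping.single v 1) ` V. \<exists>b. e = a + b" using v that by blast
  next
    assume "\<exists>a\<in>(\<lambda>v. Poly_Mapping.single v 1) ` V. \<exists>b. e = a + b"
    then obtain v b where "e = Poly_Mapping.single v 1 + b" by blast
    then have "v \<in> supp e" by (simp add: supp_add)
    then show "supp e \<notin> {{}}" by auto
  qed
  ultimately show ?thesis
    unfolding max_graded_ideal_def by (simp only:, intro genideal_monomials) (auto simp: down_closed_def)
qed

lemma Max_nat_between:
  fixes X :: "nat set"
  assumes "\<And>l. l \<in> X \<Longrightarrow> l \<le> b" "t \<in> X" "a \<le> t"
  shows "a \<le> Max X" "Max X \<le> b"
proof -
  have fin: "finite X" using assms(1) by (meson atMost_iff finite_atMost finite_subset subsetI)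
  show "a \<le> Max X" using Max_ge[OF fin assms(2)] assms(3) by simp
  show "Max X \<le> b" using fin assms(1,2) by (subst Max_le_iff) auto
qed

text \<open>
  The upper bound also serves the lower one: it makes the set of lengths of regular sequences finite, so
  that its maximum is attained and dominates \<open>t\<close>.
\<close>

theorem depth_bounds:
  fixes V :: "'v set"
  assumes V: "finite V" and \<Delta>: "down_closed \<Delta>" "\<Union>\<Delta> \<subseteq> V"
    and t: "splits t \<Delta>" and A: "facet \<Delta> A"
  shows "t \<le> depth_quot V (sr_ideal V \<Delta> :: ('v, 'k::field) mpol set)"
    and "depth_quot V (sr_ideal V \<Delta> :: ('v, 'k) mpol set) \<le> card A"
proof -
  let ?I = "sr_ideal V \<Delta> :: ('v, 'k) mpol set"
  let ?m = "max_graded_ideal V :: ('v, 'k) mpol set"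
  let ?L = "{length fs | fs. set fs \<subseteq> ?m \<and> regular_sequence (mpoly_ring V) (quot V ?I) fs}"
  have I: "poly.is_ideal V ?I" by (rule ideal_sr[OF \<Delta>(1)])
  have m: "poly.is_ideal V ?m" unfolding max_graded_ideal_eq by (rule ideal_sr) (auto simp: down_closed_def)
  have Am: "A \<in> \<Delta>" "A \<subseteq> V" using A \<Delta>(2) by (auto simp: facet_def)
  then have empty: "{} \<in> \<Delta>" using down_closedD[OF \<Delta>(1)] by blast
  have bound: "l \<le> card A" if l: "l \<in> ?L" for l
  proof -
    obtain fs where fs: "l = length fs" "set fs \<subseteq> ?m" "regular_sequence (mpoly_ring V) (quot V ?I) fs"
      using l by blast
    then have "set fs \<subseteq> polys V" "poly.weakly_regular V ?I fs" by (simp_all add: regular_sequence_quot[OF I])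
    moreover have "0 \<notin> monomials f" if "f \<in> set fs" for f
      using that fs(2) by (auto simp: max_graded_ideal_eq sr_ideal_def)
    ultimately show ?thesis
      unfolding fs(1) by (intro facet_bounds_regular[OF V \<Delta>(1) Am(2) A]) auto
  qed
  let ?fs = "elem_syms V t :: ('v, 'k) mpol list"
  have fs: "set ?fs \<subseteq> ?m"
  proof
    fix f assume "f \<in> set ?fs"
    then obtain i where i: "f = elem_sym V i" "i \<noteq> 0" by auto
    have "e \<noteq> 0" if "e \<in> monomials f" for e
      using homogeneous_elem_sym[OF V, of i, where 'k = 'k] that i
      by (auto simp: homogeneous_def total_degree_def)
    then show "f \<in> ?m" using elem_sym_polys[OF V] i(1) by (auto simp: max_graded_ideal_eq sr_ideal_def)
  qed
  have polys: "set ?fs \<subseteq> polys V" using elem_sym_polys[OF V] by auto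
  have "?I \<subseteq> ?m" using empty by (auto simp: max_graded_ideal_eq sr_ideal_def)
  then have "poly.adjoin_list V ?I ?fs \<subseteq> ?m" using fs by (rule poly.adjoin_list_least[OF m])
  moreover have "1 \<notin> ?m" by (simp add: max_graded_ideal_eq sr_ideal_def)
  ultimately have "coset V ?I 1 \<notin> seq_mult (quot V ?I) ?fs"
    unfolding seq_mult_quot[OF I polys poly.one_S] by blast
  then have "seq_mult (quot V ?I) ?fs \<noteq> carrier (quot V ?I)"
    using carrier_quot[OF I] poly.one_S by blast
  then have "regular_sequence (mpoly_ring V) (quot V ?I) ?fs"
    using splits_regular[OF t \<Delta>(1) V \<Delta>(2)] polys by (simp add: regular_sequence_quot[OF I] del: upt_Suc)
  then have "length ?fs \<in> ?L" using fs by blast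
  then have "t \<in> ?L" by (simp del: upt_Suc)
  then show "t \<le> depth_quot V ?I" "depth_quot V ?I \<le> card A"
    unfolding depth_quot_def depth_def using Max_nat_between[OF bound _ order.refl] by blast+
qed

section \<open>Stanley depth\<close>

text \<open>
  The faces avoiding \<open>v\<close> are partitioned by the deletion. The faces containing \<open>v\<close> lie in the star;
  among the intervals \<open>[T, B]\<close> of the star, those with \<open>v \<in> B\<close> are cut down to \<open>[T \<union> {v}, B]\<close>, and the others
  contain no such face.
\<close>

lemma splits_interval_partition:
  assumes "splits t \<Delta>"
  shows "\<exists>P. finite P \<and> (\<forall>(T, B)\<in>P. T \<subseteq> B \<and> B \<in> \<Delta> \<and> finite B \<and> t \<le> card B) \<and>
    (\<forall>F\<in>\<Delta>. \<exists>!I. I \<in> P \<and> fst I \<subseteq> F \<and> F \<subseteq> snd I)"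
  using assms
proof (induction rule: splits.induct)
  case (simplex B)
  then show ?case by (intro exI[of _ "{({}, B)}"]) auto
next
  case (vertex v \<Delta>)
  obtain P where P: "finite P" "\<forall>(T, B)\<in>P. T \<subseteq> B \<and> B \<in> deletion v \<Delta> \<and> finite B \<and> t \<le> card B"
    "\<forall>F\<in>deletion v \<Delta>. \<exists>!I. I \<in> P \<and> fst I \<subseteq> F \<and> F \<subseteq> snd I"
    using vertex.IH(1) by blast
  obtain Q where Q: "finite Q" "\<forall>(T, B)\<in>Q. T \<subseteq> B \<and> B \<in> star v \<Delta> \<and> finite B \<and> t \<le> card B"
    "\<forall>F\<in>star v \<Delta>. \<exists>!I. I \<in> Q \<and> fst I \<subseteq> F \<and> F \<subseteq> snd I"
    using vertex.IH(2) by blast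
  define Q' where "Q' = (\<lambda>(T, B). (insert v T, B)) ` {(T, B) \<in> Q. v \<in> B}"
  have "\<exists>!I. I \<in> P \<union> Q' \<and> fst I \<subseteq> F \<and> F \<subseteq> snd I" if F: "F \<in> \<Delta>" for F
  proof (cases "v \<in> F")
    case False
    then have "\<exists>!I. I \<in> P \<and> fst I \<subseteq> F \<and> F \<subseteq> snd I" using P(3) F by (auto simp: deletion_def)
    moreover have "I \<notin> Q'" if "fst I \<subseteq> F" for I using that False by (auto simp: Q'_def)
    ultimately show ?thesis by (metis UnE UnI1)
  next
    case True
    then have "F \<in> star v \<Delta>" using F by (simp add: star_def insert_absorb)
    then obtain T B where TB: "(T, B) \<in> Q" "T \<subseteq> F" "F \<subseteq> B"
      and unique: "\<And>T' B'. (T', B') \<in> Q \<Longrightarrow> T' \<subseteq> F \<Longrightarrow> F \<subseteq> B' \<Longrightarrow> T' = T \<and> B' = B"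
      using Q(3) by (metis fst_conv snd_conv prod.collapse)
    show ?thesis
    proof (rule ex1I[of _ "(insert v T, B)"])
      show "(insert v T, B) \<in> P \<union> Q' \<and> fst (insert v T, B) \<subseteq> F \<and> F \<subseteq> snd (insert v T, B)"
        using TB True by (force simp: Q'_def)
      fix I assume I: "I \<in> P \<union> Q' \<and> fst I \<subseteq> F \<and> F \<subseteq> snd I"
      then have "I \<notin> P" using P(2) True by (cases I) (auto simp: deletion_def)
      then obtain T' B' where I': "(T', B') \<in> Q" "I = (insert v T', B')" using I by (auto simp: Q'_def)
      then have "T' = T \<and> B' = B" using I by (intro unique) auto
      then show "I = (insert v T, B)" using I' by simp
    qed
  qed
  moreover have "finite Q'" unfolding Q'_def
    by (rule finite_imageI, rule finite_subset[OF _ Q(1)]) auto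
  moreover have "\<forall>(T, B)\<in>P \<union> Q'. T \<subseteq> B \<and> B \<in> \<Delta> \<and> finite B \<and> t \<le> card B"
    using P(2) Q(2) by (fastforce simp: Q'_def deletion_def star_def)
  ultimately show ?case using P(1) by (intro exI[of _ "P \<union> Q'"]) auto
qed

lemma stanley_space_quot:
  assumes "poly.is_ideal V J" "B \<subseteq> V" "q \<in> polys V"
  shows "stanley_space (quot V J) (coset V J q) B = {coset V J (p * q) | p. p \<in> polys B}"
proof -
  have "polys B \<subseteq> polys V" using assms(2) by (auto simp: polys_def)
  then show ?thesis
    unfolding stanley_space_def using smult_quot[OF assms(1) _ assms(3)] by (auto simp: subset_iff)
qed

text \<open>
  The monomials of \<open>x\<^sub>T K[B]\<close> are those with support in the interval \<open>[T, B]\<close>. Hence the component of a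
  polynomial \<open>p\<close> in the \<open>i\<close>-th space is its restriction \<open>q i\<close> to the monomials with support in the \<open>i\<close>-th
  interval, and it is unique because modulo \<open>I\<close> all coefficients at faces are determined.
\<close>

lemma interval_partition_stanley:
  fixes V :: "'v set"
  assumes V: "finite V" and \<Delta>: "down_closed \<Delta>" "\<Union>\<Delta> \<subseteq> V"
    and L: "distinct L" "\<And>T B. (T, B) \<in> set L \<Longrightarrow> T \<subseteq> B \<and> B \<in> \<Delta>"
      "\<And>F. F \<in> \<Delta> \<Longrightarrow> \<exists>!I. I \<in> set L \<and> fst I \<subseteq> F \<and> F \<subseteq> snd I"
  defines "I \<equiv> sr_ideal V \<Delta> :: ('v, 'k::field) mpol set"
  shows "stanley_decomposition V (quot V I) (quot_component V I)
    (map (\<lambda>(T, B). (coset V I (monom (indicator_exp T) 1), B)) L)"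
    (is "stanley_decomposition _ _ _ ?D")
proof -
  have I: "poly.is_ideal V I" unfolding I_def by (rule ideal_sr[OF \<Delta>(1)])
  define x where "x T = monom (indicator_exp T) (1::'k)" for T :: "'v set"
  have TB: "T \<subseteq> B" "B \<in> \<Delta>" "B \<subseteq> V" "finite T" "x T \<in> polys B" "x T \<in> polys V" "polys B \<subseteq> (polys V :: ('v, 'k) mpol set)"
    if "(T, B) \<in> set L" for T B
  proof -
    show TB: "T \<subseteq> B" "B \<in> \<Delta>" "B \<subseteq> V" using L(2)[OF that] \<Delta>(2) by auto
    then show "finite T" using V by (meson finite_subset)
    then show "x T \<in> polys B" unfolding x_def using TB by (intro monom_polys) (simp add: supp_indicator_exp)
    moreover show "polys B \<subseteq> (polys V :: ('v, 'k) mpol set)" using TB(3) by (auto simp: polys_def)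
    ultimately show "x T \<in> polys V" by blast
  qed
  have supp_px: "T \<subseteq> supp e" "supp e \<subseteq> B"
    if TB': "(T, B) \<in> set L" and p: "p \<in> polys B" and e: "e \<in> monomials (p * x T)" for T B p e
  proof -
    have "e \<in> monomials (x T * p)" using e by (simp add: mult.commute)
    then obtain b where "b \<in> monomials p" "e = indicator_exp T + b"
      by (auto simp: x_def monomials_monom_times)
    then show "T \<subseteq> supp e" "supp e \<subseteq> B"
      using p TB(1,4)[OF TB'] by (auto simp: supp_add supp_indicator_exp polys_def)
  qed
  let ?n = "length L"
  define T where "T i = fst (L ! i)" for i
  define B where "B i = snd (L ! i)" for i
  have L_nth: "(T i, B i) \<in> set L" if "i < ?n" for i using that by (simp add: T_def B_def)
  have D_nth: "?D ! i = (coset V I (x (T i)), B i)" if "i < ?n" for i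
    using that by (simp add: T_def B_def x_def split_beta)
  have unique_index: "i = j"
    if "i < ?n" "j < ?n" "F \<in> \<Delta>" "T i \<subseteq> F" "F \<subseteq> B i" "T j \<subseteq> F" "F \<subseteq> B j" for i j F
  proof -
    have "L ! i = L ! j"
      using L(3)[OF that(3)] L_nth[OF that(1)] L_nth[OF that(2)] that(4-7)
      by (metis T_def B_def prod.collapse)
    then show ?thesis using L(1) that(1,2) nth_eq_iff_index_eq by blast
  qed
  show ?thesis
    unfolding stanley_decomposition_def
  proof (intro conjI)
    show "\<forall>(w, A)\<in>set ?D. A \<subseteq> V" using TB(3) by auto
    show "\<forall>(w, A)\<in>set ?D. w \<in> carrier (quot V I) \<and> (\<exists>a. w \<in> quot_component V I a)"
    proof clarify
      fix w A assume "(w, A) \<in> set ?D"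
      then obtain T where T: "(T, A) \<in> set L" "w = coset V I (x T)" by (auto simp: x_def)
      then have "x T \<in> mpoly_component V (\<lambda>v. int (Poly_Mapping.lookup (indicator_exp T) v))"
        using TB(6)[OF T(1)] by (auto simp: mpoly_component_def x_def)
      then show "w \<in> carrier (quot V I) \<and> (\<exists>a. w \<in> quot_component V I a)"
        using T TB(6)[OF T(1)] carrier_quot[OF I] unfolding quot_component_def by blast
    qed
    show "\<forall>(w, A)\<in>set ?D. \<forall>p\<in>carrier (mpoly_ring A). p \<odot>\<^bsub>quot V I\<^esub> w = \<zero>\<^bsub>quot V I\<^esub> \<longrightarrow> p = 0"
    proof clarify
      fix w A and p :: "('v, 'k) mpol"
      assume "(w, A) \<in> set ?D" and p: "p \<in> carrier (mpoly_ring A)" "p \<odot>\<^bsub>quot V I\<^esub> w = \<zero>\<^bsub>quot V I\<^esub>"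
      then obtain T where T: "(T, A) \<in> set L" "w = coset V I (x T)" by (auto simp: x_def)
      have pA: "p \<in> polys A" "p \<in> polys V" using p(1) TB(7)[OF T(1)] by auto
      have "p * x T \<in> I"
        using p(2) T TB(6)[OF T(1)] pA
        by (simp add: smult_quot[OF I] zero_quot[OF I] coset_eq_iff[OF I])
      then have "supp e \<notin> \<Delta>" if "e \<in> monomials (p * x T)" for e using that by (auto simp: I_def sr_ideal_def)
      moreover have "supp e \<in> \<Delta>" if "e \<in> monomials (p * x T)" for e
        using supp_px[OF T(1) pA(1) that] TB(2)[OF T(1)] down_closedD[OF \<Delta>(1)] by blast
      ultimately have "monomials (p * x T) = {}" by blast
      then have "monomials (x T * p) = {}" by (metis mult.commute)
      then have "monomials p = {}" by (simp add: x_def monomials_monom_times del: Poly_Mapping.keys_eq_empty)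
      then show "p = 0" by simp
    qed
    show "\<forall>z\<in>carrier (quot V I). \<exists>!y. y \<in> (\<Pi>\<^sub>E i\<in>{..<length ?D}. stanley_space (quot V I) (fst (?D ! i)) (snd (?D ! i))) \<and>
            z = finsum (quot V I) y {..<length ?D}"
    proof
      fix z assume "z \<in> carrier (quot V I)"
      then obtain p where p: "p \<in> polys V" "z = coset V I p" using carrier_quot[OF I] by blast
      have space: "stanley_space (quot V I) (fst (?D ! i)) (snd (?D ! i)) = {coset V I (s * x (T i)) | s. s \<in> polys (B i)}"
        if "i < ?n" for i
        using stanley_space_quot[OF I TB(3,6)[OF L_nth[OF that]]] D_nth[OF that] by simp
      define q where "q i = poly_restrict (\<lambda>e. T i \<subseteq> supp e \<and> supp e \<subseteq> B i) p" for i
      have q_polys: "q i \<in> polys V" for i unfolding q_def using p(1) by (rule restrict_polys)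
      have q_div: "\<exists>s\<in>polys (B i). q i = s * x (T i)" if i: "i < ?n" for i
      proof -
        have fin: "finite (T i)" using TB(4)[OF L_nth[OF i]] .
        have "\<exists>e'. e = indicator_exp (T i) + e'" if "e \<in> monomials (q i)" for e
        proof
          show "e = indicator_exp (T i) + (e - indicator_exp (T i))"
            using that by (intro poly_mapping_eqI)
              (auto simp: q_def monomials_restrict lookup_add lookup_minus lookup_indicator_exp[OF fin] in_keys_iff subset_iff
                intro!: le_add_diff_inverse[symmetric])
        qed
        then obtain s where s: "q i = x (T i) * s" "\<And>e. e \<in> monomials s \<Longrightarrow> indicator_exp (T i) + e \<in> monomials (q i)"
          using divide_by_monom[of "q i" "indicator_exp (T i)"] unfolding x_def by metis
        have "s \<in> polys (B i)"
          using s(2) by (fastforce simp: polys_def q_def monomials_restrict supp_add)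
        then show ?thesis using s(1) by (auto simp: mult.commute)
      qed
      have sum_q: "p - (\<Sum>i<?n. q i) \<in> I"
      proof -
        have "supp e \<notin> \<Delta>" if e: "e \<in> monomials (p - (\<Sum>i<?n. q i))" for e
        proof
          assume eD: "supp e \<in> \<Delta>"
          then obtain j where j: "j < ?n" "T j \<subseteq> supp e" "supp e \<subseteq> B j"
            using L(3)[OF eD] by (metis T_def B_def in_set_conv_nth)
          have "coeff (\<Sum>i<?n. q i) e = (\<Sum>i<?n. if i = j then coeff p e else 0)"
            unfolding lookup_sum
          proof (rule sum.cong)
            fix i assume "i \<in> {..<?n}"
            then have "i \<noteq> j \<Longrightarrow> \<not> (T i \<subseteq> supp e \<and> supp e \<subseteq> B i)"
              using unique_index[OF _ j(1) eD _ _ j(2,3), of i] by blast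
            then show "coeff (q i) e = (if i = j then coeff p e else 0)"
              using j(2,3) by (cases "i = j") (auto simp: q_def coeff_restrict)
          qed simp
          then have "coeff (p - (\<Sum>i<?n. q i)) e = 0" using j(1) by (simp add: lookup_minus)
          then show False using e by (simp add: in_keys_iff)
        qed
        moreover have "p - (\<Sum>i<?n. q i) \<in> polys V" using p(1) q_polys by (intro poly.diff_S poly.sum_S)
        ultimately show ?thesis by (auto simp: I_def sr_ideal_def)
      qed
      show "\<exists>!y. y \<in> (\<Pi>\<^sub>E i\<in>{..<length ?D}. stanley_space (quot V I) (fst (?D ! i)) (snd (?D ! i))) \<and>
            z = finsum (quot V I) y {..<length ?D}"
      proof (rule ex1I[of _ "\<lambda>i\<in>{..<?n}. coset V I (q i)"])
        have "finsum (quot V I) (\<lambda>i\<in>{..<?n}. coset V I (q i)) {..<?n} = coset V I (\<Sum>i<?n. q i)"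
          using q_polys by (intro finsum_quot[OF I]) auto
        also have "\<dots> = z" using p(2) sum_q poly.ideal_uminus[OF I sum_q] by (simp add: coset_eq_iff[OF I])
        finally show "(\<lambda>i\<in>{..<?n}. coset V I (q i)) \<in>
            (\<Pi>\<^sub>E i\<in>{..<length ?D}. stanley_space (quot V I) (fst (?D ! i)) (snd (?D ! i))) \<and>
            z = finsum (quot V I) (\<lambda>i\<in>{..<?n}. coset V I (q i)) {..<length ?D}"
          using q_div space by fastforce
        fix y assume y: "y \<in> (\<Pi>\<^sub>E i\<in>{..<length ?D}. stanley_space (quot V I) (fst (?D ! i)) (snd (?D ! i))) \<and>
            z = finsum (quot V I) y {..<length ?D}"
        have "\<forall>i<?n. \<exists>s. s \<in> polys (B i) \<and> y i = coset V I (s * x (T i))"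
        proof (intro allI impI)
          fix i assume i: "i < ?n"
          have "y i \<in> stanley_space (quot V I) (fst (?D ! i)) (snd (?D ! i))"
            using conjunct1[OF y] by (rule PiE_mem) (simp add: i)
          then show "\<exists>s. s \<in> polys (B i) \<and> y i = coset V I (s * x (T i))"
            unfolding space[OF i] by blast
        qed
        then obtain s where s: "\<And>i. i < ?n \<Longrightarrow> s i \<in> polys (B i)" "\<And>i. i < ?n \<Longrightarrow> y i = coset V I (s i * x (T i))"
          by metis
        have sx: "s i * x (T i) \<in> polys V" if "i < ?n" for i
          using s(1)[OF that] TB(6,7)[OF L_nth[OF that]] by (blast intro: poly.mult_S)
        have "finsum (quot V I) y {..<?n} = coset V I (\<Sum>i<?n. s i * x (T i))"
          using s(2) sx by (intro finsum_quot[OF I]) auto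
        then have diff: "p - (\<Sum>i<?n. s i * x (T i)) \<in> I"
          using y p(2) by (simp add: coset_eq_iff[OF I])
        have "s i * x (T i) = q i" if i: "i < ?n" for i
        proof (rule poly_mapping_eqI)
          fix e
          show "coeff (s i * x (T i)) e = coeff (q i) e"
          proof (cases "T i \<subseteq> supp e \<and> supp e \<subseteq> B i")
            case True
            then have eD: "supp e \<in> \<Delta>" using TB(2)[OF L_nth[OF i]] down_closedD[OF \<Delta>(1)] by blast
            have "coeff (\<Sum>j<?n. s j * x (T j)) e = (\<Sum>j<?n. if j = i then coeff (s i * x (T i)) e else 0)"
              unfolding lookup_sum
            proof (rule sum.cong)
              fix j assume j: "j \<in> {..<?n}"
              then have "e \<notin> monomials (s j * x (T j))" if "j \<noteq> i"
                using supp_px[OF L_nth s(1), of j e] unique_index[OF i, of j "supp e"] True eD that by blast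
              then show "coeff (s j * x (T j)) e = (if j = i then coeff (s i * x (T i)) e else 0)"
                by (auto simp: in_keys_iff)
            qed simp
            moreover have "coeff (p - (\<Sum>j<?n. s j * x (T j))) e = 0"
              using diff eD by (auto simp: I_def sr_ideal_def in_keys_iff)
            ultimately show ?thesis using i True by (simp add: lookup_minus q_def coeff_restrict)
          next
            case False
            then show ?thesis
              using supp_px[OF L_nth[OF i] s(1)[OF i], of e] by (auto simp: q_def coeff_restrict in_keys_iff)
          qed
        qed
        then show "y = (\<lambda>i\<in>{..<?n}. coset V I (q i))"
          using y s(2) by (intro ext) (auto simp: PiE_iff extensional_def)
      qed
    qed
  qed
qed

text \<open>
  Some piece \<open>w K[B]\<close> contributes to the coefficient of \<open>x\<^sub>A\<close>, so its generator \<open>w\<close>, a single term because it is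
  homogeneous, divides \<open>x\<^sub>A\<close> with quotient \<open>x\<^sup>e\<close> in \<open>K[B]\<close>. A variable \<open>v\<close> in \<open>B\<close> outside \<open>A\<close> would give
  \<open>w x\<^sup>e v = x\<^sub>A v = 0\<close> up to a scalar, as \<open>A\<close> is a facet, against freeness. So \<open>B \<subseteq> A\<close>.
\<close>

lemma facet_bounds_stanley:
  fixes V :: "'v set"
  assumes V: "finite V" and \<Delta>: "down_closed \<Delta>" "\<Union>\<Delta> \<subseteq> V" and A: "facet \<Delta> A"
  defines "I \<equiv> sr_ideal V \<Delta> :: ('v, 'k::field) mpol set"
  assumes D: "stanley_decomposition V (quot V I) (quot_component V I) D"
  shows "stanley_decomposition_depth D \<le> card A"
proof -
  have I: "poly.is_ideal V I" unfolding I_def by (rule ideal_sr[OF \<Delta>(1)])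
  have A': "A \<in> \<Delta>" "A \<subseteq> V" "finite A" using A \<Delta>(2) V by (auto simp: facet_def intro: finite_subset)
  define x where "x = monom (indicator_exp A) (1::'k)"
  have x: "x \<in> polys V" unfolding x_def using A' by (intro monom_polys) (simp add: supp_indicator_exp)
  let ?n = "length D"
  define w where "w i = fst (D ! i)" for i
  define B where "B i = snd (D ! i)" for i
  have D_nth: "(w i, B i) \<in> set D" if "i < ?n" for i using that by (simp add: w_def B_def)
  have BV: "B i \<subseteq> V" and grad: "\<exists>a. w i \<in> quot_component V I a"
    and free: "\<forall>p\<in>polys (B i). p \<odot>\<^bsub>quot V I\<^esub> w i = \<zero>\<^bsub>quot V I\<^esub> \<longrightarrow> p = 0" if "i < ?n" for i
  proof -
    have *: "\<forall>(w, A)\<in>set D. A \<subseteq> V" "\<forall>(w, A)\<in>set D. w \<in> carrier (quot V I) \<and> (\<exists>a. w \<in> quot_component V I a)"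
      "\<forall>(w, A)\<in>set D. \<forall>p\<in>polys A. p \<odot>\<^bsub>quot V I\<^esub> w = \<zero>\<^bsub>quot V I\<^esub> \<longrightarrow> p = 0"
      using D unfolding stanley_decomposition_def by simp_all
    show "B i \<subseteq> V" "\<exists>a. w i \<in> quot_component V I a"
      "\<forall>p\<in>polys (B i). p \<odot>\<^bsub>quot V I\<^esub> w i = \<zero>\<^bsub>quot V I\<^esub> \<longrightarrow> p = 0"
      using bspec[OF *(1) D_nth[OF that]] bspec[OF *(2) D_nth[OF that]] bspec[OF *(3) D_nth[OF that]]
      by auto
  qed
  have "coset V I x \<in> carrier (quot V I)" using x carrier_quot[OF I] by blast
  then obtain y where y: "y \<in> (\<Pi>\<^sub>E i\<in>{..<?n}. stanley_space (quot V I) (w i) (B i))"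
    "coset V I x = finsum (quot V I) y {..<?n}"
  proof -
    have *: "\<forall>z\<in>carrier (quot V I). \<exists>!y. y \<in> (\<Pi>\<^sub>E i\<in>{..<?n}. stanley_space (quot V I) (w i) (B i)) \<and>
        z = finsum (quot V I) y {..<?n}"
      using D unfolding stanley_decomposition_def w_def B_def by simp
    from ex1_implies_ex[OF bspec[OF * \<open>coset V I x \<in> carrier (quot V I)\<close>]]
    show ?thesis by (elim exE conjE) (rule that)
  qed
  have "\<forall>i<?n. \<exists>m a. m \<in> mpoly_component V a \<and> w i = coset V I m"
    using grad unfolding quot_component_def by blast
  then obtain m a where m: "\<And>i. i < ?n \<Longrightarrow> m i \<in> mpoly_component V (a i)" "\<And>i. i < ?n \<Longrightarrow> w i = coset V I (m i)"
    by metis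
  have mV: "m i \<in> polys V" if "i < ?n" for i using m(1)[OF that] by (simp add: mpoly_component_def)
  have BVp: "polys (B i) \<subseteq> (polys V :: ('v, 'k) mpol set)" if "i < ?n" for i
    using BV[OF that] by (auto simp: polys_def)
  have "\<forall>i<?n. \<exists>p. p \<in> polys (B i) \<and> y i = coset V I (p * m i)"
  proof (intro allI impI)
    fix i assume i: "i < ?n"
    have "y i \<in> stanley_space (quot V I) (w i) (B i)" using y(1) by (rule PiE_mem) (simp add: i)
    then show "\<exists>p. p \<in> polys (B i) \<and> y i = coset V I (p * m i)"
      unfolding m(2)[OF i] stanley_space_quot[OF I BV[OF i] mV[OF i]] by blast
  qed
  then obtain p where p: "\<And>i. i < ?n \<Longrightarrow> p i \<in> polys (B i)" "\<And>i. i < ?n \<Longrightarrow> y i = coset V I (p i * m i)"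
    by metis
  have "finsum (quot V I) y {..<?n} = coset V I (\<Sum>i<?n. p i * m i)"
    using p(2) poly.mult_S[OF subsetD[OF BVp p(1)] mV] by (intro finsum_quot[OF I]) auto
  then have "x - (\<Sum>i<?n. p i * m i) \<in> I" using y(2) by (simp add: coset_eq_iff[OF I])
  then have "indicator_exp A \<notin> monomials (x - (\<Sum>i<?n. p i * m i))"
    using A' by (auto simp: I_def sr_ideal_def supp_indicator_exp)
  then have "(\<Sum>i<?n. coeff (p i * m i) (indicator_exp A)) = 1"
    by (simp add: in_keys_iff lookup_minus lookup_sum x_def)
  then obtain i where i: "i < ?n" "coeff (p i * m i) (indicator_exp A) \<noteq> 0"
    using sum.neutral[of "{..<?n}" "\<lambda>i. coeff (p i * m i) (indicator_exp A)"] by fastforce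
  then have "indicator_exp A \<in> monomials (p i * m i)" by (simp add: in_keys_iff)
  then obtain e b where eb: "e \<in> monomials (p i)" "b \<in> monomials (m i)" "indicator_exp A = e + b"
    using monomials_mult_subset by blast
  have mi: "m i = monom b (coeff (m i) b)"
  proof (rule poly_mapping_eqI)
    fix e'
    have "e' = b" if "e' \<in> monomials (m i)"
    proof (rule poly_mapping_eqI)
      fix v
      have "int (Poly_Mapping.lookup e' v) = int (Poly_Mapping.lookup b v)"
        using m(1)[OF i(1)] eb(2) that by (simp add: mpoly_component_def)
      then show "Poly_Mapping.lookup e' v = Poly_Mapping.lookup b v" by simp
    qed
    then show "coeff (m i) e' = coeff (monom b (coeff (m i) b)) e'"
      by (auto simp: lookup_single when_def in_keys_iff)
  qed
  have "B i \<subseteq> A"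
  proof
    fix v assume v: "v \<in> B i"
    show "v \<in> A"
    proof (rule ccontr)
      assume vA: "v \<notin> A"
      define r where "r = monom (e + Poly_Mapping.single v 1) (1::'k)"
      have r: "r \<in> polys (B i)"
        unfolding r_def using eb(1) p(1)[OF i(1)] v by (intro monom_polys) (auto simp: supp_add polys_def)
      have rm: "r * m i = monom (indicator_exp A + Poly_Mapping.single v 1) (coeff (m i) b)"
        by (subst mi) (simp add: r_def mult_single eb(3) add_ac)
      have "supp (indicator_exp A + Poly_Mapping.single v 1) = insert v A"
        using A' by (auto simp: supp_add supp_indicator_exp)
      then have "r * m i \<in> I"
        using facet_insert[OF A vA] A' v BV[OF i(1)] unfolding rm I_def sr_ideal_def
        by (auto intro!: monom_polys simp: poly.zero_S)
      then have "r \<odot>\<^bsub>quot V I\<^esub> w i = \<zero>\<^bsub>quot V I\<^esub>"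
        using m(2)[OF i(1)] mV[OF i(1)] subsetD[OF BVp[OF i(1)] r]
        by (simp add: smult_quot[OF I] zero_quot[OF I] coset_eq_iff[OF I])
      then have "r = 0" using free[OF i(1)] r by blast
      then have "monomials r = {}" by simp
      then show False by (simp add: r_def)
    qed
  qed
  then have "card (B i) \<le> card A" using A'(3) by (rule card_mono[rotated])
  moreover have "stanley_decomposition_depth D \<le> card (B i)"
    unfolding stanley_decomposition_depth_def using D_nth[OF i(1)] by (intro Min_le) force+
  ultimately show ?thesis by simp
qed

theorem sdepth_bounds:
  fixes V :: "'v set"
  assumes V: "finite V" and \<Delta>: "down_closed \<Delta>" "\<Union>\<Delta> \<subseteq> V"
    and t: "splits t \<Delta>" and A: "facet \<Delta> A"
  shows "t \<le> sdepth_quot V (sr_ideal V \<Delta> :: ('v, 'k::field) mpol set)"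
    and "sdepth_quot V (sr_ideal V \<Delta> :: ('v, 'k) mpol set) \<le> card A"
proof -
  let ?I = "sr_ideal V \<Delta> :: ('v, 'k) mpol set"
  let ?S = "{stanley_decomposition_depth D | D. stanley_decomposition V (quot V ?I) (quot_component V ?I) D}"
  have bound: "l \<le> card A" if "l \<in> ?S" for l
    using that facet_bounds_stanley[OF V \<Delta> A] by blast
  obtain P where P: "finite P" "\<forall>(T, B)\<in>P. T \<subseteq> B \<and> B \<in> \<Delta> \<and> finite B \<and> t \<le> card B"
    "\<forall>F\<in>\<Delta>. \<exists>!I. I \<in> P \<and> fst I \<subseteq> F \<and> F \<subseteq> snd I"
    using splits_interval_partition[OF t] by blast
  obtain L where L: "distinct L" "set L = P" using finite_distinct_list[OF P(1)] by blast
  define D where "D = map (\<lambda>(T, B). (coset V ?I (monom (indicator_exp T) 1), B)) L"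
  have "stanley_decomposition V (quot V ?I) (quot_component V ?I) D"
    unfolding D_def using P L by (intro interval_partition_stanley[OF V \<Delta>]) auto
  then have "stanley_decomposition_depth D \<in> ?S" by blast
  moreover have "t \<le> stanley_decomposition_depth D"
  proof -
    have "A \<in> \<Delta>" using A by (simp add: facet_def)
    then have "P \<noteq> {}" using P(3) by blast
    then have "D \<noteq> []" using L by (auto simp: D_def)
    moreover have "\<forall>(w, B)\<in>set D. t \<le> card B" using P(2) L by (auto simp: D_def)
    ultimately show ?thesis
      unfolding stanley_decomposition_depth_def by (subst Min_ge_iff) auto
  qed
  ultimately show "t \<le> sdepth_quot V ?I" "sdepth_quot V ?I \<le> card A"
    unfolding sdepth_quot_def sdepth_def using Max_nat_between[OF bound] by blast+
qed

section \<open>Independence complexes\<close>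

definition independence_complex :: "'v set set \<Rightarrow> 'v set \<Rightarrow> 'v set set" where
  "independence_complex E U = {F. F \<subseteq> U \<and> (\<forall>u\<in>F. \<forall>v\<in>F. {u, v} \<notin> E)}"

lemma down_closed_independence: "down_closed (independence_complex E U)"
  unfolding down_closed_def independence_complex_def by blast

lemma deletion_independence:
  "deletion v (independence_complex E U) = independence_complex E (U - {v})"
  unfolding deletion_def independence_complex_def by blast

text \<open>
  The vertex \<open>v\<close> survives as an isolated one, which allows it to take over a place in a packing.
\<close>

lemma star_independence:
  assumes "{v} \<notin> E" "v \<in> U"
  shows "star v (independence_complex E U) = independence_complex E (U - {u. {u, v} \<in> E})"
  using assms unfolding star_def independence_complex_def
  by (auto simp: insert_commute)

lemma edge_ideal_eq_sr:
  assumes "\<And>u v. {u, v} \<in> edges G \<Longrightarrow> u \<noteq> v \<and> u \<in> verts G \<and> v \<in> verts G"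
  shows "edge_ideal G = (sr_ideal (verts G) (independence_complex (edges G) (verts G)) :: ('v, 'k::field) mpol set)"
proof -
  let ?X = "{Poly_Mapping.single u 1 + Poly_Mapping.single v 1 | u v. {u, v} \<in> edges G} :: ('v \<Rightarrow>\<^sub>0 nat) set"
  let ?\<Delta> = "independence_complex (edges G) (verts G)"
  have supp_edge: "supp (Poly_Mapping.single u 1 + Poly_Mapping.single v 1 :: 'v \<Rightarrow>\<^sub>0 nat) = {u, v}" for u v :: 'v
    by (auto simp: supp_add)
  have "{mvar u * mvar v | u v. {u, v} \<in> edges G} = (\<lambda>a. monom a (1::'k)) ` ?X"
    by (auto simp: mvar_def mult_single image_iff)
  moreover have "supp e \<notin> ?\<Delta> \<longleftrightarrow> (\<exists>a\<in>?X. \<exists>b. e = a + b)" if e: "supp e \<subseteq> verts G" for e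
  proof
    assume "supp e \<notin> ?\<Delta>"
    then obtain u v where uv: "u \<in> supp e" "v \<in> supp e" "{u, v} \<in> edges G"
      using e by (auto simp: independence_complex_def)
    let ?a = "Poly_Mapping.single u 1 + Poly_Mapping.single v 1 :: 'v \<Rightarrow>\<^sub>0 nat"
    have "e = ?a + (e - ?a)"
      using uv assms[OF uv(3)] by (intro poly_mapping_eqI)
        (auto simp: lookup_add lookup_minus lookup_single when_def in_keys_iff)
    then show "\<exists>a\<in>?X. \<exists>b. e = a + b" using uv(3) by blast
  next
    assume "\<exists>a\<in>?X. \<exists>b. e = a + b"
    then obtain u v b where uv: "{u, v} \<in> edges G" "e = Poly_Mapping.single u 1 + Poly_Mapping.single v 1 + b"
      by blast
    then have "{u, v} \<subseteq> supp e" using supp_add[of _ b] supp_edge by blast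
    then show "supp e \<notin> ?\<Delta>" using uv(1) by (auto simp: independence_complex_def)
  qed
  moreover have "supp a \<subseteq> verts G" if "a \<in> ?X" for a using that assms supp_edge by fastforce
  ultimately show ?thesis
    unfolding edge_ideal_def by (simp only:, intro genideal_monomials down_closed_independence) auto
qed

text \<open>
  The hypothesis says that the closed neighbourhoods of the vertices in \<open>W\<close> are pairwise disjoint within \<open>U\<close>. If some
  \<open>w \<in> W\<close> has a neighbour \<open>v\<close>, split at \<open>v\<close>: deleting \<open>v\<close> keeps the packing, and in the star of \<open>v\<close> the vertex
  \<open>v\<close> becomes isolated and replaces \<open>w\<close>, the only member of \<open>W\<close> that is removed. If all of \<open>W\<close> is isolated,
  splitting at a vertex of any remaining edge leaves \<open>W\<close> untouched, until no edges remain and \<open>U\<close>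
  is a simplex containing \<open>W\<close>.
\<close>

lemma packing_splits:
  assumes "finite U" "\<And>u. {u} \<notin> E" "W \<subseteq> U" "t \<le> card W"
    and "\<And>u w w'. u \<in> U \<Longrightarrow> w \<in> W \<Longrightarrow> w' \<in> W \<Longrightarrow> u = w \<or> {u, w} \<in> E \<Longrightarrow> u = w' \<or> {u, w'} \<in> E \<Longrightarrow> w = w'"
  shows "splits t (independence_complex E U)"
  using assms(1,3-)
proof (induction U arbitrary: W rule: finite_psubset_induct)
  case (psubset U)
  have packing: "w = w'" if "u \<in> U" "w \<in> W" "w' \<in> W" "u = w \<or> {u, w} \<in> E" "u = w' \<or> {u, w'} \<in> E" for u w w'
    using psubset.prems(3) that .
  have finW: "finite W" using psubset.prems(1) psubset.hyps(1) by (rule finite_subset)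
  have split: "splits t (independence_complex E U)"
    if v: "v \<in> U" and u: "u \<in> U" "{u, v} \<in> E"
      and del: "splits t (independence_complex E (U - {v}))"
      and star: "splits t (independence_complex E (U - {u. {u, v} \<in> E}))" for u v
  proof (rule splits.vertex)
    show "{v} \<in> independence_complex E U" using v assms(2) by (auto simp: independence_complex_def)
  qed (use del star in \<open>simp_all add: deletion_independence star_independence[OF assms(2) v]\<close>)
  show ?case
  proof (cases "\<exists>w\<in>W. \<exists>v\<in>U. {v, w} \<in> E")
    case True
    then obtain w v where wv: "w \<in> W" "v \<in> U" "{v, w} \<in> E" by blast
    have wU: "w \<in> U" using wv psubset.prems by blast
    have vW: "v \<notin> W"
    proof
      assume "v \<in> W"
      then have "v = w" using packing[of v v w] wv by blast
      then show False using wv assms(2)[of v] by simp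
    qed
    have far: "{v, w'} \<notin> E" if "w' \<in> W" "w' \<noteq> w" for w' using packing[of v w w'] wv that by blast
    show ?thesis
    proof (rule split[OF wv(2) wU])
      show "{w, v} \<in> E" using wv by (simp add: insert_commute)
      show "splits t (independence_complex E (U - {v}))"
        using wv vW psubset.prems by (intro psubset.IH[of _ W]) (auto intro: packing)
      let ?W = "insert v (W - {w})"
      show "splits t (independence_complex E (U - {u. {u, v} \<in> E}))"
      proof (rule psubset.IH[of _ ?W])
        show "U - {u. {u, v} \<in> E} \<subset> U" using wU wv by (auto simp: insert_commute)
        show "?W \<subseteq> U - {u. {u, v} \<in> E}"
          using psubset.prems(1) far wv(2) assms(2)[of v] by (auto simp: insert_commute)
        have "card ?W = card W" using vW finW card_Suc_Diff1[OF finW wv(1)] by simp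
        then show "t \<le> card ?W" using psubset.prems by simp
        fix u a b
        assume u: "u \<in> U - {u. {u, v} \<in> E}" and ab: "a \<in> ?W" "b \<in> ?W"
          and near: "u = a \<or> {u, a} \<in> E" "u = b \<or> {u, b} \<in> E"
        have "a' = v" if "u = v" "a' \<in> ?W" "u = a' \<or> {u, a'} \<in> E" for a'
          using that far[of a'] by auto
        then show "a = b" using u ab near packing[of u a b] by auto
      qed
    qed
  next
    case False
    show ?thesis
    proof (cases "\<exists>u\<in>U. \<exists>v\<in>U. {u, v} \<in> E")
      case True
      then obtain u v where uv: "u \<in> U" "v \<in> U" "{u, v} \<in> E" by blast
      have "v \<notin> W" using False uv by blast
      show ?thesis
      proof (rule split[OF uv(2,1,3)])
        show "splits t (independence_complex E (U - {v}))"
          using uv \<open>v \<notin> W\<close> psubset.prems by (intro psubset.IH[of _ W]) (auto intro: packing)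
        have "W \<subseteq> U - {u. {u, v} \<in> E}" using False psubset.prems(1) uv by (auto simp: insert_commute)
        then show "splits t (independence_complex E (U - {u. {u, v} \<in> E}))"
          using uv psubset.prems by (intro psubset.IH[of _ W]) (auto intro: packing)
      qed
    next
      case False
      then have "independence_complex E U = Pow U" by (auto simp: independence_complex_def)
      moreover have "t \<le> card U" using psubset.prems psubset.hyps card_mono le_trans by blast
      ultimately show ?thesis using splits.simplex[OF psubset.hyps(1)] by metis
    qed
  qed
qed

section \<open>The strong product of a cycle with a path on three vertices\<close>

lemma strong_product_edge:
  "{p, q} \<in> edges (strong_product G H) \<longleftrightarrow>
    p \<in> verts (strong_product G H) \<and> q \<in> verts (strong_product G H) \<and> p \<noteq> q \<and>
    (fst p = fst q \<or> {fst p, fst q} \<in> edges G) \<and> (snd p = snd q \<or> {snd p, snd q} \<in> edges H)"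
  by (cases p; cases q) (auto simp: strong_product_def doubleton_eq_iff insert_commute)

definition cyclically_near :: "nat \<Rightarrow> nat \<Rightarrow> nat \<Rightarrow> bool" where
  "cyclically_near n i k \<longleftrightarrow> i = k \<or> i = k + 1 \<or> k = i + 1 \<or> (i = 1 \<and> k = n) \<or> (i = n \<and> k = 1)"

lemma cycle_graph_near:
  assumes "i \<in> {1..n}" "k \<in> {1..n}"
  shows "i = k \<or> {i, k} \<in> edges (cycle_graph n) \<longleftrightarrow> cyclically_near n i k"
  using assms by (auto simp: cycle_graph_def cyclically_near_def doubleton_eq_iff)

context
  fixes n :: nat and G :: "(nat \<times> nat) ugraph"
  assumes n: "n \<ge> 3" and G: "G = strong_product (cycle_graph n) (path_graph 3)"
begin

lemma verts_G: "verts G = {1..n} \<times> {1..3}"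
  by (simp add: G strong_product_def cycle_graph_def path_graph_def)

lemma edge_G: "{u, v} \<in> edges G \<Longrightarrow> u \<noteq> v \<and> u \<in> verts G \<and> v \<in> verts G"
  unfolding G strong_product_edge by blast

lemma edge_G_near: "{u, v} \<in> edges G \<Longrightarrow> cyclically_near n (fst u) (fst v)"
  using edge_G[of u v] cycle_graph_near[of "fst u" n "fst v"]
  unfolding G strong_product_edge by (auto simp: verts_G[unfolded G])

text \<open>
  Every row of the path on three vertices is equal or adjacent to the middle row.
\<close>

lemma middle_row_neighbourhood:
  assumes "u \<in> verts G" "c \<in> {1..n}"
  shows "u = (c, 2) \<or> {u, (c, 2)} \<in> edges G \<longleftrightarrow> cyclically_near n (fst u) c"
proof -
  have c: "(c, 2) \<in> verts G" using assms by (simp add: verts_G)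
  have "snd u = 2 \<or> {snd u, 2} \<in> edges (path_graph 3)"
  proof -
    have "{1, 2} \<in> edges (path_graph 3)" "{3, 2} \<in> edges (path_graph 3)"
      by (auto simp: path_graph_def doubleton_eq_iff intro: exI[of _ 1] exI[of _ 2])
    moreover have "snd u \<in> {1, 2, 3}" using assms(1) by (cases u) (auto simp: verts_G)
    ultimately show ?thesis by auto
  qed
  then show ?thesis
    using cycle_graph_near[of "fst u" n c] assms c
    by (cases u) (auto simp: G strong_product_edge verts_G[unfolded G] cyclically_near_def)
qed

lemma middle_row_packing:
  assumes "U \<subseteq> verts G" "C \<subseteq> {1..n}" "(\<lambda>c. (c, 2)) ` C \<subseteq> U" "t \<le> card C"
    and "\<And>k c c'. k \<in> fst ` U \<Longrightarrow> c \<in> C \<Longrightarrow> c' \<in> C \<Longrightarrow> cyclically_near n k c \<Longrightarrow> cyclically_near n k c' \<Longrightarrow> c = c'"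
  shows "splits t (independence_complex (edges G) U)"
proof (rule packing_splits[of _ _ "(\<lambda>c. (c, 2)) ` C"])
  show "finite U" using assms(1) by (rule finite_subset) (simp add: verts_G)
  show "{u} \<notin> edges G" for u using edge_G[of u u] by auto
  show "t \<le> card ((\<lambda>c. (c, 2::nat)) ` C)" using assms(4) by (simp add: card_image inj_on_def)
  show "w = w'" if "u \<in> U" "w \<in> (\<lambda>c. (c, 2)) ` C" "w' \<in> (\<lambda>c. (c, 2)) ` C"
    "u = w \<or> {u, w} \<in> edges G" "u = w' \<or> {u, w'} \<in> edges G" for u w w'
    using that assms(1,2) assms(5)[of "fst u"] middle_row_neighbourhood[of u] by blast
qed fact

text \<open>
  Unless \<open>n \<equiv> 2 (mod 3)\<close>, the middle-row vertices in the columns \<open>2, 5, 8, \<dots>\<close> form a packing of size \<open>n div 3\<close>, which is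
  the number wanted. For \<open>n = 3 k + 2\<close> split at the vertices of column \<open>n\<close>, one after the other. If a vertex of
  column \<open>n\<close> is taken (star), it is isolated and the middle-row vertices in columns \<open>3, 6, \<dots>, 3 k\<close> complete it to a
  packing of size \<open>k + 1\<close>. If all three are deleted, the columns form a path, and \<open>1, 4, \<dots>, 3 k + 1\<close> serve as columns of a
  packing, since columns \<open>1\<close> and \<open>3 k + 1\<close> no longer have a common neighbour.
\<close>

lemma grid_splits: "splits ((n + 1) div 3) (independence_complex (edges G) (verts G))"
proof (cases "n mod 3 = 2")
  case False
  have t: "(n + 1) div 3 = n div 3" using False by presburger
  show ?thesis
  proof (rule middle_row_packing)
    let ?C = "(\<lambda>j. 3 * j + 2) ` {..<n div 3}"
    show "?C \<subseteq> {1..n}" "(\<lambda>c. (c, 2)) ` ?C \<subseteq> verts G" by (auto simp: verts_G)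
    show "(n + 1) div 3 \<le> card ?C" using t by (simp add: card_image inj_on_def)
    show "c = c'" if "c \<in> ?C" "c' \<in> ?C" "cyclically_near n k c" "cyclically_near n k c'" for k c c'
    proof -
      have "j = (k - 1) div 3" if "j < n div 3" "cyclically_near n k (3 * j + 2)" for j
      proof -
        have "3 * j + 3 \<le> n" using that(1) by linarith
        then have "3 * j + 1 \<le> k" "k \<le> 3 * j + 3" using that(2) by (auto simp: cyclically_near_def)
        then show ?thesis by linarith
      qed
      then show ?thesis using that by blast
    qed
  qed simp
next
  case True
  define k where "k = n div 3"
  have nk: "n = 3 * k + 2" "(n + 1) div 3 = k + 1" using True unfolding k_def by presburger+
  define E where "E = edges G"
  have loop: "{u} \<notin> E" for u using edge_G[of u u] by (auto simp: E_def)
  have taken: "splits (k + 1) (independence_complex E (U - {u. {u, (n, i)} \<in> E}))"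
    if U: "U \<subseteq> verts G" "(n, i) \<in> U" "{u \<in> verts G. fst u \<noteq> n} \<subseteq> U" for U i
  proof -
    let ?W = "insert (n, i) ((\<lambda>j. (3 * j, 2)) ` {1..k})"
    let ?U = "U - {u. {u, (n, i)} \<in> E}"
    have near: "3 * j - 1 \<le> m \<and> m \<le> 3 * j + 1" if "j \<in> {1..k}" "cyclically_near n m (3 * j)" for j m
      using that nk by (auto simp: cyclically_near_def)
    have far: "{(3 * j, 2), (n, i)} \<notin> E" if "j \<in> {1..k}" for j
    proof
      assume "{(3 * j, 2), (n, i)} \<in> E"
      then have "cyclically_near n (3 * j) n" using edge_G_near[of "(3 * j, 2)" "(n, i)"] by (simp add: E_def)
      then show False using that nk by (auto simp: cyclically_near_def)
    qed
    show ?thesis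
    proof (rule packing_splits[OF _ loop])
      show "finite ?U" using U(1) by (intro finite_Diff finite_subset[OF U(1)]) (simp add: verts_G)
      have "(3 * j, 2) \<in> U" if "j \<in> {1..k}" for j
        using that nk U(3) by (auto simp: verts_G)
      then show "?W \<subseteq> ?U" using U(2) loop far by auto
      have "n \<noteq> 3 * j" for j using nk(1) by presburger
      then have "(n, i) \<notin> (\<lambda>j. (3 * j, 2)) ` {1..k}" by blast
      moreover have "card ((\<lambda>j. (3 * j, 2::nat)) ` {1..k}) = k" by (simp add: card_image inj_on_def)
      ultimately show "k + 1 \<le> card ?W" by simp
      fix u w w'
      assume u: "u \<in> ?U" and w: "w \<in> ?W" "w' \<in> ?W" and nb: "u = w \<or> {u, w} \<in> E" "u = w' \<or> {u, w'} \<in> E"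
      have uV: "u \<in> verts G" using u U(1) by blast
      have "w'' = (if u = (n, i) then (n, i) else (3 * ((fst u + 1) div 3), 2))"
        if w'': "w'' \<in> ?W" "u = w'' \<or> {u, w''} \<in> E" for w''
      proof (cases "w'' = (n, i)")
        case True
        then show ?thesis using w'' u by auto
      next
        case False
        then obtain j where j: "j \<in> {1..k}" "w'' = (3 * j, 2)" using w''(1) by blast
        then have "cyclically_near n (fst u) (3 * j)"
          using middle_row_neighbourhood[OF uV, of "3 * j"] w''(2) j nk by (auto simp: E_def)
        then have "3 * j - 1 \<le> fst u \<and> fst u \<le> 3 * j + 1" using near j by blast
        then have "fst u \<noteq> n" "j = (fst u + 1) div 3" using j nk by auto
        then show ?thesis using j by auto
      qed
      from this[OF w(1) nb(1)] this[OF w(2) nb(2)] show "w = w'" by simp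
    qed
  qed
  have split: "splits (k + 1) (independence_complex E U)"
    if "U \<subseteq> verts G" "(n, i) \<in> U" "{u \<in> verts G. fst u \<noteq> n} \<subseteq> U"
      "splits (k + 1) (independence_complex E (U - {(n, i)}))" for U i
  proof (rule splits.vertex)
    show "{(n, i)} \<in> independence_complex E U" using that(2) loop by (simp add: independence_complex_def)
    show "splits (k + 1) (deletion (n, i) (independence_complex E U))"
      using that(4) by (simp add: deletion_independence)
    show "splits (k + 1) (star (n, i) (independence_complex E U))"
      unfolding star_independence[OF loop that(2)] by (rule taken[OF that(1-3)])
  qed
  have path: "splits (k + 1) (independence_complex E (verts G - {(n, 1)} - {(n, 2)} - {(n, 3)}))"
    unfolding E_def
  proof (rule middle_row_packing)
    let ?C = "(\<lambda>j. 3 * j + 1) ` {..k}"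
    let ?U = "verts G - {(n, 1)} - {(n, 2)} - {(n, 3)}"
    show "?U \<subseteq> verts G" by blast
    have "3 * j + 1 \<noteq> n" for j using nk(1) by presburger
    then show "?C \<subseteq> {1..n}" "(\<lambda>c. (c, 2)) ` ?C \<subseteq> ?U" using nk by (auto simp: verts_G)
    show "k + 1 \<le> card ?C" by (simp add: card_image inj_on_def)
    show "c = c'" if "m \<in> fst ` ?U" "c \<in> ?C" "c' \<in> ?C" "cyclically_near n m c" "cyclically_near n m c'" for m c c'
    proof -
      have m: "1 \<le> m" "m < n" using that(1) by (auto simp: verts_G le_Suc_eq numeral_eq_Suc)
      have "j = m div 3" if "j \<le> k" "cyclically_near n m (3 * j + 1)" for j
      proof -
        have "3 * j \<le> m" "m \<le> 3 * j + 2" using that m nk by (auto simp: cyclically_near_def)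
        then show ?thesis by linarith
      qed
      then show ?thesis using that by blast
    qed
  qed
  have "splits (k + 1) (independence_complex E (verts G - {(n, 1)} - {(n, 2)}))"
    by (rule split[OF _ _ _ path]) (use n in \<open>auto simp: verts_G\<close>)
  then have "splits (k + 1) (independence_complex E (verts G - {(n, 1)}))"
    by (rule split[rotated 3]) (use n in \<open>auto simp: verts_G\<close>)
  then have "splits (k + 1) (independence_complex E (verts G))"
    by (rule split[rotated 3]) (use n in \<open>auto simp: verts_G\<close>)
  then show ?thesis unfolding nk(2) E_def .
qed

text \<open>
  The columns \<open>1, 4, 7, \<dots>\<close>, where for \<open>n \<equiv> 1 (mod 3)\<close> the last of them is moved from \<open>n\<close> to
  \<open>n - 1\<close>, away from column \<open>1\<close>. No two of them are adjacent, and each column is equal or adjacent to one of them.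
\<close>

lemma grid_facet:
  obtains A where "facet (independence_complex (edges G) (verts G)) A" "card A \<le> (n + 2) div 3"
proof -
  define c where "c j = min (3 * j + 1) (n - 1)" for j
  define A where "A = (\<lambda>j. (c j, 2::nat)) ` {..<(n + 2) div 3}"
  have c: "c j \<in> {1..n}" for j using n by (auto simp: c_def)
  have AV: "A \<subseteq> verts G" using c by (auto simp: A_def verts_G)
  have indep: "{u, v} \<notin> edges G" if "u \<in> A" "v \<in> A" for u v
  proof
    assume e: "{u, v} \<in> edges G"
    obtain i j where ij: "u = (c i, 2)" "v = (c j, 2)" "i < (n + 2) div 3" "j < (n + 2) div 3"
      using \<open>u \<in> A\<close> \<open>v \<in> A\<close> by (auto simp: A_def)
    have near: "cyclically_near n (c i) (c j)" "c i \<noteq> c j" using edge_G_near[OF e] edge_G[OF e] ij by auto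
    have range: "1 \<le> c l" "c l < n" for l using n by (auto simp: c_def)
    have "c i = c j + 1 \<or> c j = c i + 1"
      using near range[of i] range[of j] by (auto simp: cyclically_near_def)
    moreover have "c l = 3 * l + 1 \<or> c l = 3 * l \<and> n = 3 * l + 1" if "l < (n + 2) div 3" for l
    proof -
      have "3 * l < n" using that by linarith
      then show ?thesis unfolding c_def by linarith
    qed
    from this[OF ij(3)] this[OF ij(4)]
    have "c i = 3 * i + 1 \<or> c i = 3 * i \<and> n = 3 * i + 1" "c j = 3 * j + 1 \<or> c j = 3 * j \<and> n = 3 * j + 1" .
    ultimately show False
      using range(2)[of i] range(2)[of j] by (elim disjE conjE) presburger+
  qed
  have dominating: "\<exists>j<(n + 2) div 3. cyclically_near n k (c j)" if "k \<in> {1..n}" for k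
  \<comment> \<open>Column \<open>n = 3 q\<close> is the one case where \<open>k div 3\<close> is out of range; it is covered around the cycle by column \<open>1\<close>.\<close>
  proof (cases "k = n \<and> n mod 3 = 0")
    case True
    then show ?thesis using n by (intro exI[of _ 0]) (auto simp: cyclically_near_def c_def)
  next
    case False
    define q where "q = k div 3"
    have kn: "k \<le> n" using that by simp
    then have "q < (n + 2) div 3" using False unfolding q_def by presburger
    moreover have "cyclically_near n k (c q)"
    proof (cases "3 * q + 1 \<le> n - 1")
      case True
      have "k = 3 * q \<or> k = 3 * q + 1 \<or> k = 3 * q + 2" unfolding q_def by presburger
      then show ?thesis using True by (auto simp: cyclically_near_def c_def)
    next
      case False
      have "3 * q \<le> k" unfolding q_def by simp
      then have "k = n \<or> k + 1 = n" using False kn by linarith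
      then show ?thesis using False n by (auto simp: cyclically_near_def c_def)
    qed
    ultimately show ?thesis by blast
  qed
  have "facet (independence_complex (edges G) (verts G)) A"
    unfolding facet_def
  proof (intro conjI ballI impI)
    show "A \<in> independence_complex (edges G) (verts G)" using AV indep by (simp add: independence_complex_def)
    fix F assume F: "F \<in> independence_complex (edges G) (verts G)" "A \<subseteq> F"
    show "F = A"
    proof (rule ccontr)
      assume "F \<noteq> A"
      then obtain u where u: "u \<in> F" "u \<notin> A" using F(2) by blast
      then have uV: "u \<in> verts G" using F(1) by (auto simp: independence_complex_def)
      then have "fst u \<in> {1..n}" by (auto simp: verts_G)
      then obtain j where j: "j < (n + 2) div 3" "cyclically_near n (fst u) (c j)" using dominating by blast
      then have "u = (c j, 2) \<or> {u, (c j, 2)} \<in> edges G" using middle_row_neighbourhood[OF uV c] by blast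
      moreover have "(c j, 2) \<in> A" using j by (auto simp: A_def)
      ultimately show False using u F by (auto simp: independence_complex_def)
    qed
  qed
  moreover have "card A \<le> (n + 2) div 3" unfolding A_def using card_image_le[of "{..<(n + 2) div 3}"] by simp
  ultimately show ?thesis using that by blast
qed

end

theorem theorem3p8:
  fixes n :: nat
    and G :: "(nat \<times> nat) ugraph"
    and I :: "(nat \<times> nat, 'k::field) mpol set"
  assumes "n \<ge> 3"
    and "G = strong_product (cycle_graph n) (path_graph 3)"
    and "I = edge_ideal G"
  shows "(n mod 3 = 0 \<or> n mod 3 = 2 \<longrightarrow>
            int (depth_quot (verts G) I) = \<lceil>(real n - 1) / 3\<rceil> \<and>
            int (sdepth_quot (verts G) I) = \<lceil>(real n - 1) / 3\<rceil>) \<and>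
         (n mod 3 = 1 \<longrightarrow>
            (\<lceil>(real n - 1) / 3\<rceil> \<le> int (depth_quot (verts G) I) \<and>
             int (depth_quot (verts G) I) \<le> \<lceil>real n / 3\<rceil>) \<and>
            (\<lceil>(real n - 1) / 3\<rceil> \<le> int (sdepth_quot (verts G) I) \<and>
             int (sdepth_quot (verts G) I) \<le> \<lceil>real n / 3\<rceil>))"
proof -
  let ?\<Delta> = "independence_complex (edges G) (verts G)"
  have I: "I = sr_ideal (verts G) ?\<Delta>"
    unfolding assms(3) using edge_G[OF assms(1,2)] by (intro edge_ideal_eq_sr) blast
  have fin: "finite (verts G)" by (simp add: verts_G[OF assms(1,2)])
  have sub: "\<Union>?\<Delta> \<subseteq> verts G" by (auto simp: independence_complex_def)
  obtain A where A: "facet ?\<Delta> A" "card A \<le> (n + 2) div 3" using grid_facet[OF assms(1,2)] by blast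
  note complex = fin down_closed_independence sub grid_splits[OF assms(1,2)] A(1)
  have d: "(n + 1) div 3 \<le> depth_quot (verts G) I" "depth_quot (verts G) I \<le> (n + 2) div 3"
    unfolding I using depth_bounds[OF complex, where 'k = 'k] A(2) by simp_all
  have s: "(n + 1) div 3 \<le> sdepth_quot (verts G) I" "sdepth_quot (verts G) I \<le> (n + 2) div 3"
    unfolding I using sdepth_bounds[OF complex, where 'k = 'k] A(2) by simp_all
  have lower: "\<lceil>(real n - 1) / 3\<rceil> = int ((n + 1) div 3)"
  proof (rule ceiling_unique)
    have "n + 1 < 3 * ((n + 1) div 3) + 3" "3 * ((n + 1) div 3) \<le> n + 1" by presburger+
    then have "real (n + 1) < real (3 * ((n + 1) div 3) + 3)" "real (3 * ((n + 1) div 3)) \<le> real (n + 1)"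
      by (simp_all only: of_nat_less_iff of_nat_le_iff)
    moreover have "real (n + 1) + 1 \<le> real (3 * ((n + 1) div 3) + 3)"
      using \<open>n + 1 < 3 * ((n + 1) div 3) + 3\<close> by linarith
    ultimately show "real_of_int (int ((n + 1) div 3)) - 1 < (real n - 1) / 3"
      "(real n - 1) / 3 \<le> real_of_int (int ((n + 1) div 3))" by simp_all
  qed
  have upper: "\<lceil>real n / 3\<rceil> = int ((n + 2) div 3)"
  proof (rule ceiling_unique)
    have "n \<le> 3 * ((n + 2) div 3)" "3 * ((n + 2) div 3) < n + 3" by presburger+
    then have "real n \<le> real (3 * ((n + 2) div 3))" "real (3 * ((n + 2) div 3)) < real (n + 3)"
      by (simp_all only: of_nat_less_iff of_nat_le_iff)
    then show "real_of_int (int ((n + 2) div 3)) - 1 < real n / 3"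
      "real n / 3 \<le> real_of_int (int ((n + 2) div 3))" by simp_all
  qed
  have "n mod 3 = 0 \<or> n mod 3 = 2 \<Longrightarrow> (n + 2) div 3 = (n + 1) div 3" by presburger
  then show ?thesis
    unfolding lower upper using d s by auto
qed

end
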